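(* Consider the binary additive noisy multiple access channel with noiseless feedback, $Y=X_1+X_2+N$, where $X_1,X_2\in\{0,1\}$, addition is ordinary integer addition, and $N$ is uniform on $\{0,1\}$ and independent of $(X_1,X_2)$. Its capacity region is contained in $\mathcal{DB}^{(1)}\cap\mathcal{DB}^{(2)}$, where $\mathcal{DB}^{(1)}$ is the union, over all distributions of the form $p(t,x_1,x_2)=p(t)p(x_1|t)p(x_2|t)$ with auxiliary random variable $T$ taking at most $7$ values, of the sets of rate pairs $(R_1,R_2)$ satisfying $$R_1\le \min\bigl(I(X_1;Y|X_2),\,H(X_1|T)\bigr),\qquad R_2\le \tfrac12 H(X_2|T),\qquad R_1+R_2\le I(X_1,X_2;Y),$$ and $\mathcal{DB}^{(2)}$ is the union, over the same distributions, of the sets of rate pairs $(R_1,R_2)$ satisfying $$R_1\le \tfrac12 H(X_1|T),\qquad R_2\le \min\bigl(I(X_2;Y|X_1),\,H(X_2|T)\bigr),\qquad R_1+R_2\le I(X_1,X_2;Y).$$ Here the joint distribution is $p(t,x_1,x_2,y)=p(t)p(x_1|t)p(x_2|t)p(y|x_1,x_2)$, with $p(y|x_1,x_2)$ the channel law.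
   Context: All logarithms, entropies and mutual informations are to base 2. A discrete memoryless two-user multiple access channel with noiseless feedback (MAC-FB) consists of finite input alphabets $\mathcal X_1,\mathcal X_2$, a finite output alphabet $\mathcal Y$ and a transition law $p(y|x_1,x_2)$, used memorylessly. For the channel here $\mathcal X_1=\mathcal X_2=\{0,1\}$, $\mathcal Y=\{0,1,2,3\}$. An $(n,M_1,M_2,P_e)$ code consists of message sets $\mathcal M_k=\{1,\dots,M_k\}$ ($k=1,2$), encoding functions $e_{ki}:\mathcal M_k\times\mathcal Y^{i-1}\to\mathcal X_k$ for $k=1,2$ and $i=1,\dots,n$ (the $i$-th input of user $k$ is $e_{ki}(W_k,Y_1,\dots,Y_{i-1})$), and a decoder $g:\mathcal Y^n\to\mathcal M_1\times\mathcal M_2$. The messages $W_1,W_2$ are independent and uniform on $\mathcal M_1,\mathcal M_2$, and $P_e=\Pr(g(Y^n)\ne(W_1,W_2))$. A pair $(R_1,R_2)$ of nonnegative reals is achievable if for every $\epsilon>0$ and all sufficiently large $n$ there is a code with $R_1\le \log(M_1)/n$, $R_2\le\log(M_2)/n$ and $P_e\le\epsilon$. The capacity region is the closure of the set of achievable pairs. *)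

theory Defs
  imports "HOL-Probability.Probability"
begin

section \<open>Two-user multiple access channels with noiseless feedback\<close>

text \<open>
  A channel is given by its input alphabets \<open>A1\<close>, \<open>A2\<close>, its output alphabet \<open>B\<close> and its
  transition law \<open>W x1 x2\<close>.  Encoder \<open>k\<close> is a function \<open>e i w ys\<close> of the time
  \<open>i\<close>, the message \<open>w\<close> and the list \<open>ys\<close> of the \<open>i - 1\<close> past outputs, in order of time.
  Its values matter, and are constrained, only on the stated domain.
\<close>

definition words :: "'y set \<Rightarrow> nat \<Rightarrow> 'y list set" where
  "words B n = {ys. set ys \<subseteq> B \<and> length ys = n}"

definition is_encoder ::
  "'x set \<Rightarrow> 'y set \<Rightarrow> nat \<Rightarrow> nat \<Rightarrow> (nat \<Rightarrow> nat \<Rightarrow> 'y list \<Rightarrow> 'x) \<Rightarrow> bool" where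
  "is_encoder A B n M e \<longleftrightarrow>
     (\<forall>i\<in>{1..n}. \<forall>w\<in>{1..M}. \<forall>ys\<in>words B (i - 1). e i w ys \<in> A)"

definition is_code ::
  "'x1 set \<Rightarrow> 'x2 set \<Rightarrow> 'y set \<Rightarrow> nat \<Rightarrow> nat \<Rightarrow> nat \<Rightarrow>
   (nat \<Rightarrow> nat \<Rightarrow> 'y list \<Rightarrow> 'x1) \<Rightarrow> (nat \<Rightarrow> nat \<Rightarrow> 'y list \<Rightarrow> 'x2) \<Rightarrow>
   ('y list \<Rightarrow> nat \<times> nat) \<Rightarrow> bool" where
  "is_code A1 A2 B n M1 M2 e1 e2 g \<longleftrightarrow>
     1 \<le> M1 \<and> 1 \<le> M2 \<and>
     is_encoder A1 B n M1 e1 \<and> is_encoder A2 B n M2 e2 \<and>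
     (\<forall>ys\<in>words B n. g ys \<in> {1..M1} \<times> {1..M2})"

primrec output_pmf ::
  "('x1 \<Rightarrow> 'x2 \<Rightarrow> 'y pmf) \<Rightarrow> (nat \<Rightarrow> nat \<Rightarrow> 'y list \<Rightarrow> 'x1) \<Rightarrow> (nat \<Rightarrow> nat \<Rightarrow> 'y list \<Rightarrow> 'x2) \<Rightarrow>
   nat \<Rightarrow> nat \<Rightarrow> nat \<Rightarrow> 'y list pmf" where
  "output_pmf W e1 e2 w1 w2 0 = return_pmf []"
| "output_pmf W e1 e2 w1 w2 (Suc i) =
     bind_pmf (output_pmf W e1 e2 w1 w2 i) (\<lambda>ys.
       map_pmf (\<lambda>y. ys @ [y]) (W (e1 (Suc i) w1 ys) (e2 (Suc i) w2 ys)))"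

definition message_output_pmf ::
  "('x1 \<Rightarrow> 'x2 \<Rightarrow> 'y pmf) \<Rightarrow> nat \<Rightarrow> nat \<Rightarrow> nat \<Rightarrow>
   (nat \<Rightarrow> nat \<Rightarrow> 'y list \<Rightarrow> 'x1) \<Rightarrow> (nat \<Rightarrow> nat \<Rightarrow> 'y list \<Rightarrow> 'x2) \<Rightarrow>
   ((nat \<times> nat) \<times> 'y list) pmf" where
  "message_output_pmf W n M1 M2 e1 e2 =
     bind_pmf (pair_pmf (pmf_of_set {1..M1}) (pmf_of_set {1..M2})) (\<lambda>(w1, w2).
       map_pmf (\<lambda>ys. ((w1, w2), ys)) (output_pmf W e1 e2 w1 w2 n))"

definition error_prob ::
  "('x1 \<Rightarrow> 'x2 \<Rightarrow> 'y pmf) \<Rightarrow> nat \<Rightarrow> nat \<Rightarrow> nat \<Rightarrow>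
   (nat \<Rightarrow> nat \<Rightarrow> 'y list \<Rightarrow> 'x1) \<Rightarrow> (nat \<Rightarrow> nat \<Rightarrow> 'y list \<Rightarrow> 'x2) \<Rightarrow>
   ('y list \<Rightarrow> nat \<times> nat) \<Rightarrow> real" where
  "error_prob W n M1 M2 e1 e2 g =
     measure_pmf.prob (message_output_pmf W n M1 M2 e1 e2) {(w, ys). g ys \<noteq> w}"

definition achievable ::
  "'x1 set \<Rightarrow> 'x2 set \<Rightarrow> 'y set \<Rightarrow> ('x1 \<Rightarrow> 'x2 \<Rightarrow> 'y pmf) \<Rightarrow> real \<Rightarrow> real \<Rightarrow> bool" where
  "achievable A1 A2 B W R1 R2 \<longleftrightarrow>
     0 \<le> R1 \<and> 0 \<le> R2 \<and>
     (\<forall>\<epsilon>>0. \<forall>\<^sub>F n in sequentially. \<exists>M1 M2 e1 e2 g.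
        is_code A1 A2 B n M1 M2 e1 e2 g \<and>
        R1 \<le> log 2 (real M1) / real n \<and> R2 \<le> log 2 (real M2) / real n \<and>
        error_prob W n M1 M2 e1 e2 g \<le> \<epsilon>)"

definition capacity_region ::
  "'x1 set \<Rightarrow> 'x2 set \<Rightarrow> 'y set \<Rightarrow> ('x1 \<Rightarrow> 'x2 \<Rightarrow> 'y pmf) \<Rightarrow> (real \<times> real) set" where
  "capacity_region A1 A2 B W = closure {(R1, R2). achievable A1 A2 B W R1 R2}"

section \<open>The binary additive noisy channel\<close>

definition bits :: "nat set" where
  "bits = {0, 1}"

definition ban_outputs :: "nat set" where
  "ban_outputs = {0, 1, 2, 3}"

definition ban_channel :: "nat \<Rightarrow> nat \<Rightarrow> nat pmf" where
  "ban_channel x1 x2 = map_pmf (\<lambda>N. x1 + x2 + N) (pmf_of_set bits)"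

lemma set_pmf_ban_channel:
  "x1 \<in> bits \<Longrightarrow> x2 \<in> bits \<Longrightarrow> set_pmf (ban_channel x1 x2) \<subseteq> ban_outputs"
  by (auto simp: ban_channel_def bits_def ban_outputs_def)

section \<open>Entropies of discrete random variables, in bits\<close>

text \<open>Random variables are functions on the sample space of a \<open>pmf\<close>, with values in countable
  types; the reference measures are the full counting measures.\<close>

abbreviation cond_entropy :: "'w pmf \<Rightarrow> ('w \<Rightarrow> 'a) \<Rightarrow> ('w \<Rightarrow> 'b) \<Rightarrow> real" where
  "cond_entropy P X Y \<equiv>
     prob_space.conditional_entropy (measure_pmf P) 2 (count_space UNIV) (count_space UNIV) X Y"

abbreviation mutual_info :: "'w pmf \<Rightarrow> ('w \<Rightarrow> 'a) \<Rightarrow> ('w \<Rightarrow> 'b) \<Rightarrow> real" where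
  "mutual_info P X Y \<equiv>
     prob_space.mutual_information (measure_pmf P) 2 (count_space UNIV) (count_space UNIV) X Y"

abbreviation cond_mutual_info ::
  "'w pmf \<Rightarrow> ('w \<Rightarrow> 'a) \<Rightarrow> ('w \<Rightarrow> 'b) \<Rightarrow> ('w \<Rightarrow> 'c) \<Rightarrow> real" where
  "cond_mutual_info P X Y Z \<equiv>
     prob_space.conditional_mutual_information (measure_pmf P) 2
       (count_space UNIV) (count_space UNIV) (count_space UNIV) X Y Z"

section \<open>The dependence balance regions\<close>

definition joint_pmf ::
  "nat pmf \<Rightarrow> (nat \<Rightarrow> nat pmf) \<Rightarrow> (nat \<Rightarrow> nat pmf) \<Rightarrow> (nat \<times> nat \<times> nat \<times> nat) pmf" where
  "joint_pmf pT p1 p2 =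
     bind_pmf pT (\<lambda>t. bind_pmf (p1 t) (\<lambda>x1. bind_pmf (p2 t) (\<lambda>x2.
       map_pmf (\<lambda>y. (t, x1, x2, y)) (ban_channel x1 x2))))"

text \<open>The joint laws of \<open>(T, X1, X2, Y)\<close>.  As \<open>T\<close> enters only through its values' probabilities,
  its finite range may be taken inside the natural numbers.\<close>

definition input_laws :: "(nat \<times> nat \<times> nat \<times> nat) pmf set" where
  "input_laws = {joint_pmf pT p1 p2 | pT p1 p2.
     finite (set_pmf pT) \<and> card (set_pmf pT) \<le> 7 \<and>
     (\<forall>t\<in>set_pmf pT. set_pmf (p1 t) \<subseteq> bits \<and> set_pmf (p2 t) \<subseteq> bits)}"

definition rv_T :: "nat \<times> nat \<times> nat \<times> nat \<Rightarrow> nat" where "rv_T = (\<lambda>(t, x1, x2, y). t)"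
definition rv_X1 :: "nat \<times> nat \<times> nat \<times> nat \<Rightarrow> nat" where "rv_X1 = (\<lambda>(t, x1, x2, y). x1)"
definition rv_X2 :: "nat \<times> nat \<times> nat \<times> nat \<Rightarrow> nat" where "rv_X2 = (\<lambda>(t, x1, x2, y). x2)"
definition rv_Y :: "nat \<times> nat \<times> nat \<times> nat \<Rightarrow> nat" where "rv_Y = (\<lambda>(t, x1, x2, y). y)"

definition DB1 :: "(real \<times> real) set" where
  "DB1 = (\<Union>P\<in>input_laws. {(R1, R2). 0 \<le> R1 \<and> 0 \<le> R2 \<and>
     R1 \<le> min (cond_mutual_info P rv_X1 rv_Y rv_X2) (cond_entropy P rv_X1 rv_T) \<and>
     R2 \<le> 1 / 2 * cond_entropy P rv_X2 rv_T \<and>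
     R1 + R2 \<le> mutual_info P (\<lambda>\<omega>. (rv_X1 \<omega>, rv_X2 \<omega>)) rv_Y})"

definition DB2 :: "(real \<times> real) set" where
  "DB2 = (\<Union>P\<in>input_laws. {(R1, R2). 0 \<le> R1 \<and> 0 \<le> R2 \<and>
     R1 \<le> 1 / 2 * cond_entropy P rv_X1 rv_T \<and>
     R2 \<le> min (cond_mutual_info P rv_X2 rv_Y rv_X1) (cond_entropy P rv_X2 rv_T) \<and>
     R1 + R2 \<le> mutual_info P (\<lambda>\<omega>. (rv_X1 \<omega>, rv_X2 \<omega>)) rv_Y})"

end

theory Submission
  imports Defs "HOL-Real_Asymp.Real_Asymp"
begin

text \<open>
  Let \<open>T\<^sub>i\<close> consist of the past inputs of user 1 and the past outputs at time \<open>i\<close>. Given \<open>T\<^sub>i\<close>, the past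
  inputs of user 1 restrict only the message of user 1 and the past outputs only that of user 2, so
  the two messages, hence the two current inputs, are conditionally independent. The messages and
  the outputs together are uniform on their support, of entropy \<open>log M\<^sub>1 + log M\<^sub>2 + n\<close>, and Fano's
  inequality with chain rules for the outputs (jointly with nothing, with either message, or with the
  message of user 2 and the past inputs of user 1) bounds the rates by averages over \<open>i\<close> of
  single-letter quantities. Given one input, the output is the other input seen through an erasure
  channel with erasure probability one half, whence the factors \<open>1/2\<close>.

  All four bounds depend, concavely and continuously, on \<open>P(X\<^sub>1 = 1)\<close>, \<open>P(X\<^sub>2 = 1)\<close>,
  \<open>P(X\<^sub>1 = X\<^sub>2 = 1)\<close>, \<open>H(X\<^sub>1 | T)\<close>, \<open>H(X\<^sub>2 | T)\<close>. These five numbers range over the convex hull of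
  a compact set, so the region is closed, and by Caratheodory's theorem six values of \<open>T\<close> suffice.
  The second region follows by exchanging the users.
\<close>

section \<open>Entropy of finitely supported laws\<close>

text \<open>With feedback the inputs are dependent, so a history must decouple them. The outputs
  alone do not suffice; adding the past inputs of user 1 does, and this history is still a function
  of the first message and the past outputs. It can thus be joined at no cost to the conditioning
  when \<open>W1\<close> is known; this choice of user is the source of the asymmetry between
  \<open>H(X1 | T)\<close> and \<open>H(X2 | T) / 2\<close>.

  The joint entropy of messages and outputs is known exactly, and Fano's inequality, used once for
  the pair of messages, compares it with the entropy of \<open>(V, outputs)\<close> for four choices
  of \<open>V\<close>. So every rate bound comes from an upper bound on an output entropy. Each
  channel use contributes its noise bit there, and these \<open>n\<close> bits cancel.

  The mutual informations of the region are not conditioned on \<open>T\<close>; they see only the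
  law of the two inputs, and Jensen's inequality handles their averages. No time-sharing variable is
  introduced: averages over time are convex combinations of points of the hull.

  The calculus uses joint entropies only. As an expectation over the sample space,
  \<open>ent\<close> makes sense for values of any type.\<close>

definition ent :: "'w pmf \<Rightarrow> ('w \<Rightarrow> 'a) \<Rightarrow> real" where
  "ent P X = measure_pmf.expectation P (\<lambda>\<omega>. - log 2 (pmf (map_pmf X P) (X \<omega>)))"

definition eta :: "real \<Rightarrow> real" where
  "eta x = - (x * log 2 x)"

lemma ent_map_pmf: "ent (map_pmf g P) X = ent P (\<lambda>\<omega>. X (g \<omega>))"
  by (simp add: ent_def map_pmf_comp)

lemma expectation_map_pmf_eq_sum:
  fixes f :: "'a \<Rightarrow> real"
  assumes "finite A" "X ` set_pmf P \<subseteq> A"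
  shows "measure_pmf.expectation P (\<lambda>\<omega>. f (X \<omega>)) = (\<Sum>x\<in>A. pmf (map_pmf X P) x * f x)"
proof -
  have "measure_pmf.expectation P (\<lambda>\<omega>. f (X \<omega>)) = measure_pmf.expectation (map_pmf X P) f"
    by simp
  also have "\<dots> = (\<Sum>x\<in>A. f x * pmf (map_pmf X P) x)"
    using assms by (intro integral_measure_pmf_real) auto
  finally show ?thesis by (simp add: mult.commute)
qed

lemma ent_eq_sum:
  assumes "finite A" "X ` set_pmf P \<subseteq> A"
  shows "ent P X = (\<Sum>x\<in>A. eta (pmf (map_pmf X P) x))"
  unfolding ent_def
  by (subst expectation_map_pmf_eq_sum[OF assms]) (simp add: eta_def)

text \<open>Only the probabilities of level sets enter, so entropy depends on the partition that a
  variable induces on the support. This serves throughout to regroup tuples and to add or remove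
  determined components.\<close>

lemma ent_cong:
  assumes "\<And>\<omega> \<omega>'. \<omega> \<in> set_pmf P \<Longrightarrow> \<omega>' \<in> set_pmf P \<Longrightarrow> X \<omega> = X \<omega>' \<longleftrightarrow> Y \<omega> = Y \<omega>'"
  shows "ent P X = ent P Y"
  unfolding ent_def
proof (rule integral_cong_AE)
  show "AE \<omega> in measure_pmf P. - log 2 (pmf (map_pmf X P) (X \<omega>)) = - log 2 (pmf (map_pmf Y P) (Y \<omega>))"
  proof (subst AE_measure_pmf_iff, intro ballI)
    fix \<omega> assume w: "\<omega> \<in> set_pmf P"
    have "measure_pmf.prob P (X -` {X \<omega>}) = measure_pmf.prob P (Y -` {Y \<omega>})"
      using assms w by (intro measure_pmf.finite_measure_eq_AE) (auto simp: AE_measure_pmf_iff)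
    then show "- log 2 (pmf (map_pmf X P) (X \<omega>)) = - log 2 (pmf (map_pmf Y P) (Y \<omega>))"
      by (simp add: pmf_map)
  qed
qed auto

lemma pmf_map_pos: "\<omega> \<in> set_pmf P \<Longrightarrow> 0 < pmf (map_pmf X P) (X \<omega>)"
  by (simp add: pmf_positive)

text \<open>Gibbs' inequality, with a correction for \<open>q\<close> of total mass other than 1.\<close>

lemma ent_le_cross_entropy:
  fixes q :: "'a \<Rightarrow> real"
  assumes P: "finite (set_pmf P)" and A: "finite A" "X ` set_pmf P \<subseteq> A"
    and q: "\<And>\<omega>. \<omega> \<in> set_pmf P \<Longrightarrow> 0 < q (X \<omega>)" "\<And>x. x \<in> A \<Longrightarrow> 0 \<le> q x"
  shows "ent P X \<le> measure_pmf.expectation P (\<lambda>\<omega>. - log 2 (q (X \<omega>))) + (sum q A - 1) / ln 2"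
proof -
  let ?p = "\<lambda>x. pmf (map_pmf X P) x"
  have int: "integrable (measure_pmf P) f" for f :: "_ \<Rightarrow> real"
    by (rule integrable_measure_pmf_finite[OF P])
  have "ent P X - measure_pmf.expectation P (\<lambda>\<omega>. - log 2 (q (X \<omega>)))
      = measure_pmf.expectation P (\<lambda>\<omega>. - log 2 (?p (X \<omega>)) - - log 2 (q (X \<omega>)))"
    unfolding ent_def by (rule Bochner_Integration.integral_diff[symmetric]) (rule int)+
  also have "\<dots> \<le> measure_pmf.expectation P (\<lambda>\<omega>. (q (X \<omega>) / ?p (X \<omega>) - 1) / ln 2)"
  proof (rule integral_mono_AE[OF int int], subst AE_measure_pmf_iff, intro ballI)
    fix \<omega> assume w: "\<omega> \<in> set_pmf P"
    have pos: "0 < ?p (X \<omega>)" "0 < q (X \<omega>)" using pmf_map_pos[OF w] q(1)[OF w] by auto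
    then have "- log 2 (?p (X \<omega>)) - - log 2 (q (X \<omega>)) = ln (q (X \<omega>) / ?p (X \<omega>)) / ln 2"
      by (simp add: log_def ln_div diff_divide_distrib)
    also have "\<dots> \<le> (q (X \<omega>) / ?p (X \<omega>) - 1) / ln 2"
      using pos by (intro divide_right_mono ln_le_minus_one) auto
    finally show "- log 2 (?p (X \<omega>)) - - log 2 (q (X \<omega>)) \<le> (q (X \<omega>) / ?p (X \<omega>) - 1) / ln 2" .
  qed
  also have "\<dots> = (measure_pmf.expectation P (\<lambda>\<omega>. q (X \<omega>) / ?p (X \<omega>)) - 1) / ln 2"
    by (simp add: Bochner_Integration.integral_diff[OF int int])
  also have "measure_pmf.expectation P (\<lambda>\<omega>. q (X \<omega>) / ?p (X \<omega>)) = (\<Sum>x\<in>A. ?p x * (q x / ?p x))"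
    by (rule expectation_map_pmf_eq_sum[OF A])
  \<comment> \<open>Where \<open>?p x = 0\<close> the quotient is 0 by convention, so the term is 0
    and not \<open>q x\<close>; hence an inequality.\<close>
  also have "\<dots> \<le> sum q A"
    using q(2) by (intro sum_mono) simp
  finally show ?thesis by (simp add: divide_right_mono)
qed

lemma sum_pmf_map_Pair:
  assumes P: "finite A" "X ` set_pmf P \<subseteq> A"
  shows "(\<Sum>x\<in>A. pmf (map_pmf (\<lambda>\<omega>. (X \<omega>, Z \<omega>)) P) (x, z)) = pmf (map_pmf Z P) z"
proof -
  have "(\<Sum>x\<in>A. pmf (map_pmf (\<lambda>\<omega>. (X \<omega>, Z \<omega>)) P) (x, z))
      = (\<Sum>x\<in>A. measure_pmf.prob P {\<omega>. X \<omega> = x \<and> Z \<omega> = z})"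
    by (intro sum.cong refl) (auto simp: pmf_map vimage_def)
  also have "\<dots> = measure_pmf.prob P (\<Union>x\<in>A. {\<omega>. X \<omega> = x \<and> Z \<omega> = z})"
    using P by (subst measure_pmf.finite_measure_finite_Union) (auto simp: disjoint_family_on_def)
  also have "\<dots> = measure_pmf.prob P {\<omega>. Z \<omega> = z}"
    using P by (intro measure_pmf.finite_measure_eq_AE) (auto simp: AE_measure_pmf_iff)
  finally show ?thesis by (simp add: pmf_map vimage_def)
qed

text \<open>This is \<open>I(X; Y | Z) \<ge> 0\<close>: Gibbs' inequality against the law
  \<open>p(x, z) p(y, z) / p(z)\<close>, which keeps the two pair marginals and makes
  \<open>X\<close> and \<open>Y\<close> conditionally independent given \<open>Z\<close>.\<close>

lemma ent_submodular:
  assumes P: "finite (set_pmf P)"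
  shows "ent P (\<lambda>\<omega>. (X \<omega>, Y \<omega>, Z \<omega>)) + ent P Z
       \<le> ent P (\<lambda>\<omega>. (X \<omega>, Z \<omega>)) + ent P (\<lambda>\<omega>. (Y \<omega>, Z \<omega>))"
proof -
  let ?S = "set_pmf P"
  define xz where "xz = pmf (map_pmf (\<lambda>\<omega>. (X \<omega>, Z \<omega>)) P)"
  define yz where "yz = pmf (map_pmf (\<lambda>\<omega>. (Y \<omega>, Z \<omega>)) P)"
  define pz where "pz = pmf (map_pmf Z P)"
  define q where "q = (\<lambda>(x, y, z). xz (x, z) * yz (y, z) / pz z)"
  have int: "integrable (measure_pmf P) f" for f :: "_ \<Rightarrow> real"
    by (rule integrable_measure_pmf_finite[OF P])
  have pos: "0 < xz (X \<omega>, Z \<omega>)" "0 < yz (Y \<omega>, Z \<omega>)" "0 < pz (Z \<omega>)" if "\<omega> \<in> ?S" for \<omega>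
    unfolding xz_def yz_def pz_def
    using pmf_map_pos[OF that, of "\<lambda>\<omega>. (X \<omega>, Z \<omega>)"] pmf_map_pos[OF that, of "\<lambda>\<omega>. (Y \<omega>, Z \<omega>)"]
      pmf_map_pos[OF that, of Z] by auto
  have "sum q (X ` ?S \<times> Y ` ?S \<times> Z ` ?S)
      = (\<Sum>x\<in>X ` ?S. \<Sum>y\<in>Y ` ?S. \<Sum>z\<in>Z ` ?S. xz (x, z) * yz (y, z) / pz z)"
    by (simp only: q_def sum.cartesian_product[symmetric] case_prod_conv)
  also have "\<dots> = (\<Sum>x\<in>X ` ?S. \<Sum>z\<in>Z ` ?S. \<Sum>y\<in>Y ` ?S. xz (x, z) * yz (y, z) / pz z)"
    by (intro sum.cong refl sum.swap)
  also have "\<dots> = (\<Sum>z\<in>Z ` ?S. \<Sum>x\<in>X ` ?S. \<Sum>y\<in>Y ` ?S. xz (x, z) * yz (y, z) / pz z)"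
    by (rule sum.swap)
  also have "\<dots> = (\<Sum>z\<in>Z ` ?S. (\<Sum>x\<in>X ` ?S. xz (x, z)) * (\<Sum>y\<in>Y ` ?S. yz (y, z)) / pz z)"
    by (simp only: sum_product sum_divide_distrib)
  also have "\<dots> = (\<Sum>z\<in>Z ` ?S. pz z)"
    using P by (simp add: xz_def yz_def pz_def sum_pmf_map_Pair)
  also have "\<dots> = 1"
    unfolding pz_def using P by (intro sum_pmf_eq_1) auto
  finally have mass: "sum q (X ` ?S \<times> Y ` ?S \<times> Z ` ?S) = 1" .
  have "ent P (\<lambda>\<omega>. (X \<omega>, Y \<omega>, Z \<omega>))
      \<le> measure_pmf.expectation P (\<lambda>\<omega>. - log 2 (q (X \<omega>, Y \<omega>, Z \<omega>)))
        + (sum q (X ` ?S \<times> Y ` ?S \<times> Z ` ?S) - 1) / ln 2"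
    using P pos by (intro ent_le_cross_entropy)
      (auto simp: q_def xz_def yz_def pz_def intro!: divide_nonneg_nonneg mult_nonneg_nonneg)
  also have "measure_pmf.expectation P (\<lambda>\<omega>. - log 2 (q (X \<omega>, Y \<omega>, Z \<omega>)))
      = measure_pmf.expectation P (\<lambda>\<omega>. - log 2 (xz (X \<omega>, Z \<omega>)) + - log 2 (yz (Y \<omega>, Z \<omega>)) - - log 2 (pz (Z \<omega>)))"
  proof (rule integral_cong_AE)
    show "AE \<omega> in measure_pmf P. - log 2 (q (X \<omega>, Y \<omega>, Z \<omega>))
        = - log 2 (xz (X \<omega>, Z \<omega>)) + - log 2 (yz (Y \<omega>, Z \<omega>)) - - log 2 (pz (Z \<omega>))"
    proof (subst AE_measure_pmf_iff, intro ballI)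
      fix \<omega> assume "\<omega> \<in> ?S"
      from pos[OF this] show "- log 2 (q (X \<omega>, Y \<omega>, Z \<omega>))
        = - log 2 (xz (X \<omega>, Z \<omega>)) + - log 2 (yz (Y \<omega>, Z \<omega>)) - - log 2 (pz (Z \<omega>))"
        by (simp add: q_def log_mult log_divide)
    qed
  qed auto
  also have "\<dots> = ent P (\<lambda>\<omega>. (X \<omega>, Z \<omega>)) + ent P (\<lambda>\<omega>. (Y \<omega>, Z \<omega>)) - ent P Z"
    unfolding ent_def xz_def yz_def pz_def
    by (subst Bochner_Integration.integral_diff[OF int int], subst Bochner_Integration.integral_add[OF int int])
       simp
  finally show ?thesis using mass by simp
qed

lemma ent_const: "ent P (\<lambda>_. c) = 0"
  by (simp add: ent_def)

lemma ent_mono: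
  assumes P: "finite (set_pmf P)"
    and f: "\<And>\<omega> \<omega>'. \<omega> \<in> set_pmf P \<Longrightarrow> \<omega>' \<in> set_pmf P \<Longrightarrow> X \<omega> = X \<omega>' \<Longrightarrow> Y \<omega> = Y \<omega>'"
  shows "ent P Y \<le> ent P X"
  unfolding ent_def
proof (intro integral_mono_AE integrable_measure_pmf_finite[OF P], subst AE_measure_pmf_iff, intro ballI)
  fix \<omega> assume w: "\<omega> \<in> set_pmf P"
  have "measure_pmf.prob P (X -` {X \<omega>}) \<le> measure_pmf.prob P (Y -` {Y \<omega>})"
  proof (rule measure_pmf.finite_measure_mono_AE)
    have "\<forall>\<omega>'\<in>set_pmf P. X \<omega>' = X \<omega> \<longrightarrow> Y \<omega>' = Y \<omega>" using f w by blast
    then show "AE \<omega>' in measure_pmf P. \<omega>' \<in> X -` {X \<omega>} \<longrightarrow> \<omega>' \<in> Y -` {Y \<omega>}"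
      by (subst AE_measure_pmf_iff) simp
  qed simp
  then show "- log 2 (pmf (map_pmf Y P) (Y \<omega>)) \<le> - log 2 (pmf (map_pmf X P) (X \<omega>))"
    using pmf_map_pos[OF w, of X] by (simp add: pmf_map)
qed

lemma ent_le_log_card:
  assumes P: "finite (set_pmf P)" and A: "finite A" "X ` set_pmf P \<subseteq> A"
  shows "ent P X \<le> log 2 (card A)"
proof -
  have "A \<noteq> {}" using A set_pmf_not_empty[of P] by auto
  then have c: "0 < real (card A)" using A(1) by (simp add: card_gt_0_iff)
  have "ent P X \<le> measure_pmf.expectation P (\<lambda>\<omega>. - log 2 (1 / card A))
        + ((\<Sum>x\<in>A. 1 / card A) - 1) / ln 2"
    using c by (intro ent_le_cross_entropy[OF P A, of "\<lambda>_. 1 / card A"]) auto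
  also have "\<dots> = log 2 (card A)" using c by (simp add: log_divide)
  finally show ?thesis .
qed

text \<open>Gibbs' inequality against \<open>p(y)\<close> times 1 at the decoded value and
  \<open>1 / card A\<close> elsewhere. This has mass at most 2 rather than 1, and the correction
  \<open>1 / ln 2 \<le> 2\<close> takes the place of the usual binary entropy of the error
  probability.\<close>

lemma ent_fano:
  assumes P: "finite (set_pmf P)" and A: "finite A" "V ` set_pmf P \<subseteq> A"
  shows "ent P (\<lambda>\<omega>. (V \<omega>, Y \<omega>)) - ent P Y
       \<le> 2 + measure_pmf.prob P {\<omega>. g (Y \<omega>) \<noteq> V \<omega>} * log 2 (card A)"
proof -
  let ?S = "set_pmf P"
  have int: "integrable (measure_pmf P) f" for f :: "_ \<Rightarrow> real"
    by (rule integrable_measure_pmf_finite[OF P])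
  have "A \<noteq> {}" using A set_pmf_not_empty[of P] by auto
  then have c: "0 < real (card A)" using A(1) by (simp add: card_gt_0_iff)
  define py where "py = pmf (map_pmf Y P)"
  define q where "q = (\<lambda>(v, y). py y / (if g y = v then 1 else card A))"
  have "sum q (A \<times> Y ` ?S) = (\<Sum>y\<in>Y ` ?S. \<Sum>v\<in>A. q (v, y))"
    by (subst sum.swap) (simp add: sum.cartesian_product)
  also have "\<dots> \<le> (\<Sum>y\<in>Y ` ?S. py y * 2)"
  proof (rule sum_mono)
    fix y
    have "(\<Sum>v\<in>A. q (v, y)) \<le> (\<Sum>v\<in>A. py y * ((if g y = v then 1 else 0) + 1 / card A))"
      using c by (intro sum_mono) (auto simp: q_def py_def field_simps)
    also have "\<dots> = py y * ((if g y \<in> A then 1 else 0) + 1)"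
      using c A(1) by (simp only: sum_distrib_left[symmetric] sum.distrib) (simp add: sum.delta' \<open>A \<noteq> {}\<close>)
    also have "\<dots> \<le> py y * 2"
      by (intro mult_left_mono) (auto simp: py_def)
    finally show "(\<Sum>v\<in>A. q (v, y)) \<le> py y * 2" .
  qed
  also have "\<dots> = 2"
    unfolding py_def sum_distrib_right[symmetric] using P by (subst sum_pmf_eq_1) auto
  finally have mass: "sum q (A \<times> Y ` ?S) \<le> 2" .
  have py: "0 < py (Y \<omega>)" if "\<omega> \<in> ?S" for \<omega>
    using pmf_map_pos[OF that, of Y] by (simp add: py_def)
  have "ent P (\<lambda>\<omega>. (V \<omega>, Y \<omega>)) \<le> measure_pmf.expectation P (\<lambda>\<omega>. - log 2 (q (V \<omega>, Y \<omega>)))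
        + (sum q (A \<times> Y ` ?S) - 1) / ln 2"
    using P A c py by (intro ent_le_cross_entropy) (auto simp: q_def py_def)
  also have "measure_pmf.expectation P (\<lambda>\<omega>. - log 2 (q (V \<omega>, Y \<omega>)))
     = measure_pmf.expectation P (\<lambda>\<omega>. - log 2 (py (Y \<omega>)) + indicator {\<omega>. g (Y \<omega>) \<noteq> V \<omega>} \<omega> * log 2 (card A))"
  proof (rule integral_cong_AE)
    show "AE \<omega> in measure_pmf P. - log 2 (q (V \<omega>, Y \<omega>))
        = - log 2 (py (Y \<omega>)) + indicator {\<omega>. g (Y \<omega>) \<noteq> V \<omega>} \<omega> * log 2 (card A)"
    proof (subst AE_measure_pmf_iff, intro ballI)
      fix \<omega> assume "\<omega> \<in> ?S"
      from py[OF this] c show "- log 2 (q (V \<omega>, Y \<omega>))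
        = - log 2 (py (Y \<omega>)) + indicator {\<omega>. g (Y \<omega>) \<noteq> V \<omega>} \<omega> * log 2 (card A)"
        by (auto simp: q_def log_divide)
    qed
  qed auto
  also have "\<dots> = ent P Y + measure_pmf.prob P {\<omega>. g (Y \<omega>) \<noteq> V \<omega>} * log 2 (card A)"
    unfolding ent_def py_def by (subst Bochner_Integration.integral_add[OF int int]) simp
  also have "(sum q (A \<times> Y ` ?S) - 1) / ln 2 \<le> 1 / (1 / 2)"
  proof -
    have "1 / 2 \<le> ln (2::real)" using ln2_ge_two_thirds by simp
    then show ?thesis using mass by (intro frac_le) auto
  qed
  finally show ?thesis by simp
qed

section \<open>Agreement with the entropies of the library\<close>

lemma distributed_pmf:
  "distributed (measure_pmf P) (count_space UNIV) X (\<lambda>x. ennreal (pmf (map_pmf X P) x))"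
  using map_pmf_rep_eq[of X P] measure_pmf_eq_density[of "map_pmf X P"]
  by (simp add: distributed_def)

lemma information_space_pmf: "information_space (measure_pmf P) 2"
  by unfold_locales simp

text \<open>The library takes entropies of pairs with respect to the product of the reference
  measures; for countable types this is again a counting measure.\<close>

lemma pair_count_space_UNIV:
  "count_space (UNIV :: 'a :: countable set) \<Otimes>\<^sub>M count_space (UNIV :: 'b :: countable set) = count_space UNIV"
  by (subst pair_measure_countable) auto

lemma entropy_pmf: "prob_space.entropy (measure_pmf P) 2 (count_space UNIV) X = ent P X"
proof -
  interpret information_space "measure_pmf P" 2 by (rule information_space_pmf)
  let ?p = "pmf (map_pmf X P)"
  have "ent P X = measure_pmf.expectation (map_pmf X P) (\<lambda>x. - log 2 (?p x))"
    by (simp add: ent_def)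
  also have "\<dots> = - (\<integral>x. ?p x * log 2 (?p x) \<partial>count_space UNIV)"
    by (subst measure_pmf_eq_density) (subst integral_density, auto)
  finally show ?thesis
    by (subst entropy_distr[OF distributed_pmf]) auto
qed

lemma integrable_count_space_pmf_mult:
  fixes f :: "'a \<Rightarrow> real"
  assumes "finite (set_pmf p)"
  shows "integrable (count_space UNIV) (\<lambda>x. pmf p x * f x)"
proof -
  have "integrable (measure_pmf p) f" by (rule integrable_measure_pmf_finite[OF assms])
  then show ?thesis by (subst (asm) measure_pmf_eq_density) (subst (asm) integrable_density, auto)
qed

lemma cond_entropy_eq_ent:
  fixes X :: "'w \<Rightarrow> 'a :: countable" and Y :: "'w \<Rightarrow> 'b :: countable"
  assumes P: "finite (set_pmf P)"
  shows "cond_entropy P X Y = ent P (\<lambda>\<omega>. (X \<omega>, Y \<omega>)) - ent P Y"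
proof -
  interpret information_space "measure_pmf P" 2 by (rule information_space_pmf)
  show ?thesis
    unfolding entropy_pmf[symmetric] pair_count_space_UNIV[symmetric]
    by (rule conditional_entropy_eq_entropy[where Py="pmf (map_pmf Y P)"
          and Pxy="pmf (map_pmf (\<lambda>\<omega>. (X \<omega>, Y \<omega>)) P)"])
      (auto simp: pair_count_space_UNIV P sigma_finite_measure_count_space_countable
        intro!: distributed_pmf integrable_count_space_pmf_mult)
qed

lemma mutual_info_eq_ent:
  fixes X :: "'w \<Rightarrow> 'a :: countable" and Y :: "'w \<Rightarrow> 'b :: countable"
  assumes P: "finite (set_pmf P)"
  shows "mutual_info P X Y = ent P X + ent P Y - ent P (\<lambda>\<omega>. (X \<omega>, Y \<omega>))"
proof -
  interpret information_space "measure_pmf P" 2 by (rule information_space_pmf)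
  show ?thesis
    unfolding entropy_pmf[symmetric] pair_count_space_UNIV[symmetric]
    by (rule mutual_information_eq_entropy_conditional_entropy_distr
          [where Px="pmf (map_pmf X P)" and Py="pmf (map_pmf Y P)"
          and Pxy="pmf (map_pmf (\<lambda>\<omega>. (X \<omega>, Y \<omega>)) P)"])
      (auto simp: pair_count_space_UNIV P sigma_finite_measure_count_space_countable
        intro!: distributed_pmf integrable_count_space_pmf_mult)
qed

text \<open>By definition in the library this quantity is \<open>I(X; (Y, Z)) - I(X; Z)\<close>, so
  the formula for mutual information applies twice.\<close>

lemma cond_mutual_info_eq_ent:
  fixes X :: "'w \<Rightarrow> 'a :: countable" and Y :: "'w \<Rightarrow> 'b :: countable" and Z :: "'w \<Rightarrow> 'c :: countable"
  assumes P: "finite (set_pmf P)"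
  shows "cond_mutual_info P X Y Z = ent P (\<lambda>\<omega>. (X \<omega>, Z \<omega>)) + ent P (\<lambda>\<omega>. (Y \<omega>, Z \<omega>))
      - ent P (\<lambda>\<omega>. (X \<omega>, Y \<omega>, Z \<omega>)) - ent P Z"
proof -
  show ?thesis
    unfolding prob_space.conditional_mutual_information_def[OF measure_pmf.prob_space_axioms] pair_count_space_UNIV
      mutual_info_eq_ent[OF P] by simp
qed

section \<open>Probabilities of laws built from kernels\<close>

lemma pmf_bind_map_Pair:
  "pmf (bind_pmf p (\<lambda>x. map_pmf (Pair x) (K x))) (x, y) = pmf p x * pmf (K x) y"
proof -
  have "pmf (map_pmf (Pair x') (K x')) (x, y) = indicator {x} x' * pmf (K x) y" for x'
  proof (cases "x' = x")
    case True
    then show ?thesis using pmf_map_inj'[of "Pair x" "K x" y] by (simp add: inj_on_def)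
  next
    case False
    then have "pmf (map_pmf (Pair x') (K x')) (x, y) = 0" by (intro pmf_map_outside) auto
    then show ?thesis using False by simp
  qed
  then show ?thesis
    by (simp add: pmf_bind measure_pmf_single)
qed

lemma pmf_bind_map_snoc:
  "pmf (bind_pmf p (\<lambda>ys. map_pmf (\<lambda>y. ys @ [y]) (K ys))) (ys @ [y]) = pmf p ys * pmf (K ys) y"
proof -
  have "bind_pmf p (\<lambda>ys. map_pmf (\<lambda>y. ys @ [y]) (K ys))
      = map_pmf (\<lambda>(ys, y). ys @ [y]) (bind_pmf p (\<lambda>x. map_pmf (Pair x) (K x)))"
    by (simp add: map_bind_pmf map_pmf_comp)
  moreover have "inj (\<lambda>(ys, y :: 'a). ys @ [y])" by (auto simp: inj_on_def)
  ultimately show ?thesis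
    using pmf_map_inj'[of "\<lambda>(ys, y). ys @ [y]" _ "(ys, y)"] by (simp add: pmf_bind_map_Pair)
qed

lemma ban_channel_commute: "ban_channel x1 x2 = ban_channel x2 x1"
  by (simp add: ban_channel_def add.commute)

lemma pmf_ban_channel: "pmf (ban_channel x1 x2) y = (if y = x1 + x2 \<or> y = x1 + x2 + 1 then 1 / 2 else 0)"
proof -
  have inj: "inj ((+) (x1 + x2))" by simp
  show ?thesis
  proof (cases "\<exists>N. y = x1 + x2 + N")
    case True
    then obtain N where N: "y = x1 + x2 + N" by blast
    have "pmf (ban_channel x1 x2) y = pmf (pmf_of_set bits) N"
      unfolding ban_channel_def N by (rule pmf_map_inj'[OF inj])
    also have "\<dots> = (if N \<in> bits then 1 / 2 else 0)"
      by (auto simp: bits_def)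
    finally show ?thesis using N by (auto simp: bits_def)
  next
    case False
    then have "y \<notin> (\<lambda>N. x1 + x2 + N) ` set_pmf (pmf_of_set bits)" by auto
    then have "pmf (ban_channel x1 x2) y = 0"
      unfolding ban_channel_def by (rule pmf_map_outside)
    then show ?thesis using False by auto
  qed
qed

lemma set_pmf_ban_channel_eq: "set_pmf (ban_channel x1 x2) = {x1 + x2, x1 + x2 + 1}"
  by (auto simp: set_pmf_eq pmf_ban_channel)

section \<open>The channel at a single time\<close>

lemma eta_0 [simp]: "eta 0 = 0"
  by (simp add: eta_def)

lemma eta_1 [simp]: "eta 1 = 0"
  by (simp add: eta_def)

lemma eta_half: "eta (x / 2) = eta x / 2 + x / 2"
  by (simp add: eta_def log_def ln_div algebra_simps diff_divide_distrib)

lemma eta_mult: "eta (x * y) = x * eta y + y * eta x"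
  by (simp add: eta_def log_def ln_mult algebra_simps add_divide_distrib)

text \<open>The type of \<open>t\<close> is left open: it is \<open>nat\<close> for the laws of the
  theorem and a pair of lists for the laws that a code induces.\<close>

definition chan_law :: "('t \<times> nat \<times> nat) pmf \<Rightarrow> ('t \<times> nat \<times> nat \<times> nat) pmf" where
  "chan_law J = bind_pmf J (\<lambda>(t, x1, x2). map_pmf (\<lambda>y. (t, x1, x2, y)) (ban_channel x1 x2))"

lemma map_pmf_chan_law:
  "map_pmf (\<lambda>(t, x1, x2, y). (t, x1, x2)) (chan_law J) = J"
  by (simp add: chan_law_def map_bind_pmf map_pmf_comp case_prod_unfold bind_return_pmf')

lemma finite_set_pmf_chan_law: "finite (set_pmf J) \<Longrightarrow> finite (set_pmf (chan_law J))"
  by (auto simp: chan_law_def set_pmf_ban_channel_eq)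

lemma ent_chan_law: "ent (chan_law J) (\<lambda>(t, x1, x2, y). f t x1 x2) = ent J (\<lambda>(t, x1, x2). f t x1 x2)"
proof -
  have "ent J (\<lambda>(t, x1, x2). f t x1 x2)
      = ent (map_pmf (\<lambda>(t, x1, x2, y). (t, x1, x2)) (chan_law J)) (\<lambda>(t, x1, x2). f t x1 x2)"
    by (simp add: map_pmf_chan_law)
  also have "\<dots> = ent (chan_law J) (\<lambda>(t, x1, x2, y). f t x1 x2)"
    unfolding ent_map_pmf by (simp add: case_prod_unfold)
  finally show ?thesis ..
qed

text \<open>Given a shift \<open>s z\<close> of the output, a binary input \<open>x\<close> is received as
  \<open>s z + x + N\<close>, that is, through a channel that erases it with probability one half.\<close>

definition shift_law :: "('z \<Rightarrow> nat) \<Rightarrow> ('z \<times> nat) pmf \<Rightarrow> (nat \<times> 'z \<times> nat) pmf" where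
  "shift_law s R = bind_pmf R (\<lambda>(z, x). map_pmf (\<lambda>y. (x, z, y)) (ban_channel x (s z)))"

lemma pmf_shift_law: "pmf (shift_law s R) (x, z, y) = pmf R (z, x) * pmf (ban_channel x (s z)) y"
proof -
  let ?B = "bind_pmf R (\<lambda>zx. map_pmf (Pair zx) (ban_channel (snd zx) (s (fst zx))))"
  let ?f = "\<lambda>((z, x), y). (x, z, y)"
  have "shift_law s R = map_pmf ?f ?B"
    by (simp add: shift_law_def map_bind_pmf map_pmf_comp case_prod_unfold)
  moreover have "pmf (map_pmf ?f ?B) (?f ((z, x), y)) = pmf ?B ((z, x), y)"
    by (rule pmf_map_inj') (auto simp: inj_on_def)
  ultimately show ?thesis by (simp add: pmf_bind_map_Pair)
qed

lemma sum_bits: "(\<Sum>x\<in>bits. f x) = f 0 + f (1::nat)"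
  by (simp add: bits_def)

lemma set_pmf_shift_law: "set_pmf (shift_law s R) = (\<Union>(z, x)\<in>set_pmf R. {(x, z, x + s z), (x, z, x + s z + 1)})"
  by (simp add: shift_law_def case_prod_unfold set_pmf_ban_channel_eq)

text \<open>Given \<open>z\<close>, the outputs \<open>s z\<close>, \<open>s z + 1\<close>,
  \<open>s z + 2\<close> have weights \<open>p0 / 2\<close>, \<open>(p0 + p1) / 2\<close>,
  \<open>p1 / 2\<close>. The outer two reveal \<open>x\<close> and give half of
  \<open>H(Z, X)\<close>; the middle one is the erasure and gives half of \<open>H(Z)\<close>;
  halving the weights costs one bit. The second equation says that the noise is a fair bit
  independent of the rest.\<close>

lemma ent_shift_law:
  assumes R: "finite (set_pmf R)" "snd ` set_pmf R \<subseteq> bits"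
  shows "ent (shift_law s R) snd = ent R (\<lambda>w. w) / 2 + ent R fst / 2 + 1"
    and "ent (shift_law s R) (\<lambda>w. w) = ent R (\<lambda>w. w) + 1"
proof -
  let ?S = "fst ` set_pmf R"
  let ?p = "\<lambda>z x. pmf R (z, x)"
  have fin: "finite ?S" using R by simp
  have supp: "set_pmf R \<subseteq> ?S \<times> bits" using R(2) by force
  have marg: "pmf (map_pmf fst R) z = ?p z 0 + ?p z 1" for z
  proof -
    have "(\<Sum>x\<in>bits. pmf (map_pmf (\<lambda>w. (snd w, fst w)) R) (x, z)) = pmf (map_pmf fst R) z"
      using R(2) by (intro sum_pmf_map_Pair) (auto simp: bits_def)
    moreover have "pmf (map_pmf (\<lambda>w. (snd w, fst w)) R) (x, z) = ?p z x" for x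
      using pmf_map_inj'[of "\<lambda>w. (snd w, fst w)" R "(z, x)"] by (auto simp: inj_on_def)
    ultimately show ?thesis by (simp add: sum_bits)
  qed
  have total: "(\<Sum>z\<in>?S. ?p z 0 + ?p z 1) = 1"
    using sum_pmf_eq_1[of ?S "map_pmf fst R"] fin by (simp add: marg)
  have "ent R (\<lambda>w. w) = (\<Sum>w\<in>?S \<times> bits. eta (pmf R w))"
    using supp fin by (subst ent_eq_sum[of "?S \<times> bits"]) (auto simp: bits_def)
  also have "\<dots> = (\<Sum>z\<in>?S. \<Sum>x\<in>bits. eta (?p z x))"
    by (simp add: sum.cartesian_product)
  finally have entR: "ent R (\<lambda>w. w) = (\<Sum>z\<in>?S. eta (?p z 0) + eta (?p z 1))"
    by (simp only: sum_bits)
  have entR1: "ent R fst = (\<Sum>z\<in>?S. eta (?p z 0 + ?p z 1))"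
    using fin by (subst ent_eq_sum[of ?S]) (auto simp: marg)

  let ?Q = "shift_law s R"
  have out: "pmf (map_pmf snd ?Q) (z, y)
     = ?p z 0 * pmf (ban_channel 0 (s z)) y + ?p z 1 * pmf (ban_channel 1 (s z)) y" for z y
  proof -
    have "(\<Sum>x\<in>bits. pmf (map_pmf (\<lambda>w. (fst w, snd w)) ?Q) (x, (z, y))) = pmf (map_pmf snd ?Q) (z, y)"
      using R(2) by (intro sum_pmf_map_Pair) (force simp: bits_def set_pmf_shift_law)+
    then show ?thesis by (simp add: sum_bits pmf_shift_law)
  qed
  \<comment> \<open>Outputs are indexed by their offset \<open>k\<close> from the shift, a value of
    \<open>x + N\<close>.\<close>
  have inj: "inj_on (\<lambda>(z, k). (z, s z + k)) (?S \<times> {0, 1, 2 :: nat})"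
    by (auto simp: inj_on_def)
  have "ent ?Q snd = (\<Sum>w\<in>(\<lambda>(z, k). (z, s z + k)) ` (?S \<times> {0, 1, 2}). eta (pmf (map_pmf snd ?Q) w))"
  proof (rule ent_eq_sum)
    show "snd ` set_pmf ?Q \<subseteq> (\<lambda>(z, k). (z, s z + k)) ` (?S \<times> {0, 1, 2})"
    proof
      fix w assume "w \<in> snd ` set_pmf ?Q"
      then obtain z x where zx: "(z, x) \<in> set_pmf R" "w = (z, x + s z) \<or> w = (z, x + s z + 1)"
        by (auto simp: set_pmf_shift_law)
      moreover from zx(1) have "x = 0 \<or> x = 1" "z \<in> ?S" using supp by (auto simp: bits_def)
      ultimately obtain k where "k \<in> {0, 1, 2}" "w = (z, s z + k)" by auto
      then show "w \<in> (\<lambda>(z, k). (z, s z + k)) ` (?S \<times> {0, 1, 2})"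
        using \<open>z \<in> ?S\<close> by (intro rev_image_eqI[of "(z, k)"]) auto
    qed
  qed (use fin in simp)
  also have "\<dots> = (\<Sum>z\<in>?S. \<Sum>k\<in>{0, 1, 2}. eta (pmf (map_pmf snd ?Q) (z, s z + k)))"
    by (subst sum.reindex[OF inj]) (simp only: sum.cartesian_product comp_def case_prod_unfold fst_conv snd_conv)
  also have "\<dots> = (\<Sum>z\<in>?S. (eta (?p z 0) + eta (?p z 1)) / 2 + eta (?p z 0 + ?p z 1) / 2 + (?p z 0 + ?p z 1))"
  proof (rule sum.cong[OF refl])
    fix z
    have "(\<Sum>k\<in>{0, 1, 2}. eta (pmf (map_pmf snd ?Q) (z, s z + k)))
       = eta (?p z 0 / 2) + eta ((?p z 0 + ?p z 1) / 2) + eta (?p z 1 / 2)"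
      by (simp add: out pmf_ban_channel add_divide_distrib)
    also have "\<dots> = (eta (?p z 0) + eta (?p z 1)) / 2 + eta (?p z 0 + ?p z 1) / 2 + (?p z 0 + ?p z 1)"
      unfolding eta_half by (simp add: field_simps)
    finally show "(\<Sum>k\<in>{0, 1, 2}. eta (pmf (map_pmf snd ?Q) (z, s z + k))) = \<dots>" .
  qed
  also have "\<dots> = ent R (\<lambda>w. w) / 2 + ent R fst / 2 + 1"
    unfolding sum.distrib total[unfolded sum.distrib] entR entR1 by (simp add: sum_divide_distrib sum.distrib add_divide_distrib)
  finally show "ent (shift_law s R) snd = ent R (\<lambda>w. w) / 2 + ent R fst / 2 + 1" .

  have inj': "inj_on (\<lambda>((z, x), k). (x, z, x + s z + k)) (set_pmf R \<times> bits)"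
    by (auto simp: inj_on_def)
  have "ent ?Q (\<lambda>w. w) = (\<Sum>w\<in>(\<lambda>((z, x), k). (x, z, x + s z + k)) ` (set_pmf R \<times> bits). eta (pmf ?Q w))"
  proof (subst ent_eq_sum)
    show "(\<lambda>w. w) ` set_pmf ?Q \<subseteq> (\<lambda>((z, x), k). (x, z, x + s z + k)) ` (set_pmf R \<times> bits)"
    proof
      fix w assume "w \<in> (\<lambda>w. w) ` set_pmf ?Q"
      then obtain z x where "(z, x) \<in> set_pmf R" "w = (x, z, x + s z + 0) \<or> w = (x, z, x + s z + 1)"
        by (auto simp: set_pmf_shift_law)
      then obtain k where "(z, x) \<in> set_pmf R" "k \<in> bits" "w = (x, z, x + s z + k)"
        by (auto simp: bits_def)
      then show "w \<in> (\<lambda>((z, x), k). (x, z, x + s z + k)) ` (set_pmf R \<times> bits)"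
        by (intro rev_image_eqI[of "((z, x), k)"]) auto
    qed
  qed (use R in \<open>simp_all add: bits_def\<close>)
  also have "\<dots> = (\<Sum>zx\<in>set_pmf R. \<Sum>k\<in>bits. eta (pmf R zx / 2))"
    unfolding sum.reindex[OF inj'] sum.cartesian_product
    by (intro sum.cong refl) (auto simp: pmf_shift_law pmf_ban_channel bits_def)
  also have "\<dots> = (\<Sum>zx\<in>set_pmf R. eta (pmf R zx)) + (\<Sum>zx\<in>set_pmf R. pmf R zx)"
    unfolding sum_bits eta_half by (simp add: sum.distrib[symmetric])
  also have "(\<Sum>zx\<in>set_pmf R. pmf R zx) = 1" using R by (intro sum_pmf_eq_1) auto
  also have "(\<Sum>zx\<in>set_pmf R. eta (pmf R zx)) = ent R (\<lambda>w. w)"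
    using R by (subst ent_eq_sum) auto
  finally show "ent (shift_law s R) (\<lambda>w. w) = ent R (\<lambda>w. w) + 1" .
qed

definition binary_law :: "('t \<times> nat \<times> nat) pmf \<Rightarrow> bool" where
  "binary_law J \<longleftrightarrow> finite (set_pmf J) \<and> set_pmf J \<subseteq> UNIV \<times> bits \<times> bits"

text \<open>The side information \<open>f t x2\<close> may be anything from which \<open>s\<close>
  recovers the shift \<open>x2\<close>; later it is \<open>x2\<close> alone or the pair
  \<open>(t, x2)\<close>.\<close>

lemma chan_law_eq_shift_law:
  assumes "\<And>t x2. s (f t x2) = x2"
  shows "map_pmf (\<lambda>(t, x1, x2, y). (x1, f t x2, y)) (chan_law J)
       = shift_law s (map_pmf (\<lambda>(t, x1, x2). (f t x2, x1)) J)"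
  by (simp add: chan_law_def shift_law_def map_bind_pmf map_pmf_comp bind_map_pmf case_prod_unfold assms)

lemma ent_chan_law_side:
  assumes J: "binary_law J" and s: "\<And>t x2. s (f t x2) = x2"
  shows "ent (chan_law J) (\<lambda>(t, x1, x2, y). (f t x2, y))
       = ent J (\<lambda>(t, x1, x2). (f t x2, x1)) / 2 + ent J (\<lambda>(t, x1, x2). f t x2) / 2 + 1"
    and "ent (chan_law J) (\<lambda>(t, x1, x2, y). (x1, f t x2, y)) = ent J (\<lambda>(t, x1, x2). (f t x2, x1)) + 1"
proof -
  let ?R = "map_pmf (\<lambda>(t, x1, x2). (f t x2, x1)) J"
  have R: "finite (set_pmf ?R)" "snd ` set_pmf ?R \<subseteq> bits"
    using J by (auto simp: binary_law_def)
  note e = ent_shift_law[OF R, of s, folded chan_law_eq_shift_law[where s = s and f = f, OF s], unfolded ent_map_pmf]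
  show "ent (chan_law J) (\<lambda>(t, x1, x2, y). (f t x2, y))
       = ent J (\<lambda>(t, x1, x2). (f t x2, x1)) / 2 + ent J (\<lambda>(t, x1, x2). f t x2) / 2 + 1"
    using e(1) by (simp add: case_prod_unfold)
  show "ent (chan_law J) (\<lambda>(t, x1, x2, y). (x1, f t x2, y)) = ent J (\<lambda>(t, x1, x2). (f t x2, x1)) + 1"
    using e(2) by (simp add: case_prod_unfold)
qed

section \<open>Exchange of the two users\<close>

definition swap_law :: "('t \<times> nat \<times> nat) pmf \<Rightarrow> ('t \<times> nat \<times> nat) pmf" where
  "swap_law = map_pmf (\<lambda>(t, x1, x2). (t, x2, x1))"

lemma binary_law_swap: "binary_law J \<Longrightarrow> binary_law (swap_law J)"
  by (auto simp: binary_law_def swap_law_def)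

lemma chan_law_swap: "chan_law (swap_law J) = map_pmf (\<lambda>(t, x1, x2, y). (t, x2, x1, y)) (chan_law J)"
  by (simp add: chan_law_def swap_law_def map_bind_pmf map_pmf_comp bind_map_pmf case_prod_unfold
      ban_channel_commute[of "fst (snd _)"])

lemma ent_swap_law: "ent (swap_law J) X = ent J (\<lambda>(t, x1, x2). X (t, x2, x1))"
  by (simp add: swap_law_def ent_map_pmf case_prod_unfold)

lemma ent_chan_law_swap:
  "ent (chan_law (swap_law J)) X = ent (chan_law J) (\<lambda>(t, x1, x2, y). X (t, x2, x1, y))"
  by (simp add: chan_law_swap ent_map_pmf case_prod_unfold)

text \<open>\<open>I(X\<^sub>1; Y | X\<^sub>2)\<close> and \<open>I(X\<^sub>1, X\<^sub>2; Y)\<close> in terms of \<open>a = P(X\<^sub>1 = 1)\<close>, \<open>b = P(X\<^sub>2 = 1)\<close> and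
  \<open>c = P(X\<^sub>1 = X\<^sub>2 = 1)\<close>.\<close>

definition info_one :: "real \<Rightarrow> real \<Rightarrow> real \<Rightarrow> real" where
  "info_one a b c = (eta (1 - a - b + c) + eta (a - c) + eta (b - c) + eta c - eta b - eta (1 - b)) / 2"

definition info_both :: "real \<Rightarrow> real \<Rightarrow> real \<Rightarrow> real" where
  "info_both a b c = eta ((1 - a - b + c) / 2) + eta ((1 - c) / 2) + eta ((a + b - c) / 2) + eta (c / 2) - 1"

section \<open>Entropies of one channel use in terms of the five numbers\<close>

definition mean1 :: "('t \<times> nat \<times> nat) pmf \<Rightarrow> real" where
  "mean1 J = pmf (map_pmf (\<lambda>(t, x1, x2). x1) J) 1"

definition mean2 :: "('t \<times> nat \<times> nat) pmf \<Rightarrow> real" where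
  "mean2 J = pmf (map_pmf (\<lambda>(t, x1, x2). x2) J) 1"

definition mean12 :: "('t \<times> nat \<times> nat) pmf \<Rightarrow> real" where
  "mean12 J = pmf (map_pmf snd J) (1, 1)"

definition cond_ent1 :: "('t \<times> nat \<times> nat) pmf \<Rightarrow> real" where
  "cond_ent1 J = ent J (\<lambda>(t, x1, x2). (t, x1)) - ent J fst"

definition cond_ent2 :: "('t \<times> nat \<times> nat) pmf \<Rightarrow> real" where
  "cond_ent2 J = ent J (\<lambda>(t, x1, x2). (t, x2)) - ent J fst"

lemma binary_law_probs:
  assumes J: "binary_law J"
  shows "pmf (map_pmf snd J) (1, 1) = mean12 J"
    and "pmf (map_pmf snd J) (1, 0) = mean1 J - mean12 J"
    and "pmf (map_pmf snd J) (0, 1) = mean2 J - mean12 J"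
    and "pmf (map_pmf snd J) (0, 0) = 1 - mean1 J - mean2 J + mean12 J"
    and "pmf (map_pmf (\<lambda>(t, x1, x2). x2) J) 0 = 1 - mean2 J"
proof -
  let ?q = "\<lambda>x1 x2. pmf (map_pmf snd J) (x1, x2)"
  show 11: "?q 1 1 = mean12 J" by (simp add: mean12_def)
  have m2: "?q 0 x + ?q 1 x = pmf (map_pmf (\<lambda>(t, x1, x2). x2) J) x" for x
  proof -
    have "(\<Sum>y\<in>bits. pmf (map_pmf (\<lambda>w. (fst (snd w), snd (snd w))) J) (y, x)) = pmf (map_pmf (\<lambda>w. snd (snd w)) J) x"
      using J by (intro sum_pmf_map_Pair) (auto simp: binary_law_def bits_def)
    then show ?thesis by (simp add: sum_bits case_prod_unfold)
  qed
  have m1: "?q x 0 + ?q x 1 = pmf (map_pmf (\<lambda>(t, x1, x2). x1) J) x" for x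
  proof -
    have "(\<Sum>y\<in>bits. pmf (map_pmf (\<lambda>w. (snd (snd w), fst (snd w))) J) (y, x)) = pmf (map_pmf (\<lambda>w. fst (snd w)) J) x"
      using J by (intro sum_pmf_map_Pair) (auto simp: binary_law_def bits_def)
    moreover have "pmf (map_pmf (\<lambda>w. (snd (snd w), fst (snd w))) J) (y, x) = ?q x y" for y
      by (auto simp: pmf_map intro!: arg_cong[where f = "measure_pmf.prob J"])
    ultimately show ?thesis by (simp add: sum_bits case_prod_unfold)
  qed
  have tot: "(?q 0 0 + ?q 1 0) + (?q 0 1 + ?q 1 1) = 1"
  proof -
    have "(\<Sum>x\<in>bits. pmf (map_pmf (\<lambda>(t, x1, x2). x2) J) x) = 1"
      using J by (intro sum_pmf_eq_1) (auto simp: binary_law_def bits_def)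
    then show ?thesis using m2[of 0] m2[of 1] by (simp add: sum_bits)
  qed
  show 10: "?q 1 0 = mean1 J - mean12 J" using m1[of 1] 11 by (simp add: mean1_def)
  show 01: "?q 0 1 = mean2 J - mean12 J" using m2[of 1] 11 by (simp add: mean2_def)
  show "?q 0 0 = 1 - mean1 J - mean2 J + mean12 J" using tot 11 10 01 by simp
  show "pmf (map_pmf (\<lambda>(t, x1, x2). x2) J) 0 = 1 - mean2 J"
    using tot 11 10 01 by (simp add: m2[symmetric])
qed

lemma ent_inputs:
  assumes J: "binary_law J"
  shows "ent J snd - ent J (\<lambda>(t, x1, x2). x2) = 2 * info_one (mean1 J) (mean2 J) (mean12 J)"
proof -
  have "ent J snd = (\<Sum>x\<in>bits \<times> bits. eta (pmf (map_pmf snd J) x))"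
    using J by (intro ent_eq_sum) (auto simp: bits_def binary_law_def)
  also have "\<dots> = (\<Sum>x\<in>bits. \<Sum>y\<in>bits. eta (pmf (map_pmf snd J) (x, y)))"
    by (simp add: sum.cartesian_product)
  finally have 1: "ent J snd = (\<Sum>x\<in>bits. \<Sum>y\<in>bits. eta (pmf (map_pmf snd J) (x, y)))" .
  have "ent J (\<lambda>(t, x1, x2). x2) = (\<Sum>x\<in>bits. eta (pmf (map_pmf (\<lambda>(t, x1, x2). x2) J) x))"
    using J by (intro ent_eq_sum) (auto simp: bits_def binary_law_def)
  also have "\<dots> = eta (mean2 J) + eta (1 - mean2 J)"
    by (simp only: sum_bits binary_law_probs[OF J] mean2_def[symmetric])
  finally show ?thesis
    unfolding 1 sum_bits binary_law_probs[OF J] info_one_def by (simp add: field_simps)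
qed

lemma ent_output:
  assumes J: "binary_law J"
  shows "ent (chan_law J) (\<lambda>(t, x1, x2, y). y) = 1 + info_both (mean1 J) (mean2 J) (mean12 J)"
proof -
  let ?Y = "map_pmf (\<lambda>(t, x1, x2, y). y) (chan_law J)"
  let ?q = "\<lambda>x1 x2. pmf (map_pmf snd J) (x1, x2)"
  have Y: "?Y = bind_pmf (map_pmf snd J) (\<lambda>(x1, x2). ban_channel x1 x2)"
    by (simp add: chan_law_def map_bind_pmf bind_map_pmf map_pmf_comp case_prod_unfold)
  have p: "pmf ?Y y = (\<Sum>x1\<in>bits. \<Sum>x2\<in>bits. pmf (ban_channel x1 x2) y * ?q x1 x2)" for y
  proof -
    have "pmf ?Y y = (\<Sum>x\<in>bits \<times> bits. pmf (ban_channel (fst x) (snd x)) y * pmf (map_pmf snd J) x)"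
      unfolding Y pmf_bind using J
      by (subst integral_measure_pmf_real[of "bits \<times> bits"])
        (auto simp: bits_def binary_law_def case_prod_unfold)
    then show ?thesis by (simp add: sum.cartesian_product case_prod_unfold)
  qed
  have "ent (chan_law J) (\<lambda>(t, x1, x2, y). y) = (\<Sum>y\<in>{0, 1, 2, 3}. eta (pmf ?Y y))"
    using J by (intro ent_eq_sum) (auto simp: chan_law_def set_pmf_ban_channel_eq bits_def binary_law_def)
  also have "\<dots> = eta (?q 0 0 / 2) + eta ((?q 0 0 + ?q 1 0 + ?q 0 1) / 2)
      + eta ((?q 1 0 + ?q 0 1 + ?q 1 1) / 2) + eta (?q 1 1 / 2)"
    by (simp add: p sum_bits pmf_ban_channel add_divide_distrib add_ac)
  also have "\<dots> = 1 + info_both (mean1 J) (mean2 J) (mean12 J)"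
    unfolding binary_law_probs[OF J] info_both_def by (simp add: algebra_simps)
  finally show ?thesis .
qed

lemma ent_chan_law_inputs_output:
  assumes J: "binary_law J"
  shows "ent (chan_law J) (\<lambda>(t, x1, x2, y). (x1, x2, y)) = ent J snd + 1"
proof -
  have "ent J (\<lambda>(t, x1, x2). (x2, x1)) = ent J snd" by (rule ent_cong) auto
  then show ?thesis
    using ent_chan_law_side(2)[OF J, of id "\<lambda>t x2. x2"] by simp
qed

text \<open>The erasure identity gives \<open>H(Y | X2) = 1 + H(X1 | X2) / 2\<close>. The 1 is the
  noise, so \<open>info_one\<close> is half of \<open>H(X1 | X2)\<close>.\<close>

lemma ent_output_given_input2:
  assumes J: "binary_law J"
  shows "ent (chan_law J) (\<lambda>(t, x1, x2, y). (x2, y)) - ent J (\<lambda>(t, x1, x2). x2)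
       = 1 + info_one (mean1 J) (mean2 J) (mean12 J)"
proof -
  have "ent J (\<lambda>(t, x1, x2). (x2, x1)) = ent J snd" by (rule ent_cong) auto
  then show ?thesis
    using ent_chan_law_side(1)[OF J, of id "\<lambda>t x2. x2"] ent_inputs[OF J] by (simp add: field_simps)
qed

lemma mean_swap [simp]: "mean1 (swap_law J) = mean2 J" "mean2 (swap_law J) = mean1 J"
  by (simp_all add: mean1_def mean2_def swap_law_def map_pmf_comp case_prod_unfold)

lemma mean12_swap [simp]: "mean12 (swap_law J) = mean12 J"
  by (auto simp: mean12_def swap_law_def pmf_map vimage_def case_prod_unfold
      intro!: arg_cong[where f = "measure_pmf.prob J"])

lemma ent_output_given_input1:
  assumes J: "binary_law J"
  shows "ent (chan_law J) (\<lambda>(t, x1, x2, y). (x1, y)) - ent J (\<lambda>(t, x1, x2). x1)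
       = 1 + info_one (mean2 J) (mean1 J) (mean12 J)"
  using ent_output_given_input2[OF binary_law_swap[OF J]]
  unfolding ent_chan_law_swap ent_swap_law by (simp add: case_prod_unfold)

text \<open>With \<open>(T, X1)\<close> as side information the erasure identity gives
  \<open>1 + H(X2 | T, X1) / 2\<close>; submodularity then removes \<open>X1\<close> from the
  conditioning.\<close>

lemma ent_output_given_input1_aux_le:
  assumes J: "binary_law J"
  shows "ent (chan_law J) (\<lambda>(t, x1, x2, y). (t, x1, y)) - ent J (\<lambda>(t, x1, x2). (t, x1))
       \<le> 1 + cond_ent2 J / 2"
proof -
  let ?J = "swap_law J"
  have fin: "finite (set_pmf J)" using J by (simp add: binary_law_def)
  have "ent (chan_law ?J) (\<lambda>(t, x1, x2, y). ((t, x2), y))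
      = ent ?J (\<lambda>(t, x1, x2). ((t, x2), x1)) / 2 + ent ?J (\<lambda>(t, x1, x2). (t, x2)) / 2 + 1"
    using ent_chan_law_side(1)[OF binary_law_swap[OF J], of snd Pair] by simp
  then have 1: "ent (chan_law J) (\<lambda>(t, x1, x2, y). ((t, x1), y))
      = ent J (\<lambda>(t, x1, x2). ((t, x1), x2)) / 2 + ent J (\<lambda>(t, x1, x2). (t, x1)) / 2 + 1"
    unfolding ent_chan_law_swap ent_swap_law by (simp add: case_prod_unfold)
  have 2: "ent (chan_law J) (\<lambda>(t, x1, x2, y). ((t, x1), y)) = ent (chan_law J) (\<lambda>(t, x1, x2, y). (t, x1, y))"
    by (rule ent_cong) auto
  have "ent J (\<lambda>w. (fst (snd w), snd (snd w), fst w)) + ent J fst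
      \<le> ent J (\<lambda>w. (fst (snd w), fst w)) + ent J (\<lambda>w. (snd (snd w), fst w))"
    by (rule ent_submodular[OF fin])
  moreover have "ent J (\<lambda>w. (fst (snd w), snd (snd w), fst w)) = ent J (\<lambda>(t, x1, x2). ((t, x1), x2))"
    by (rule ent_cong) auto
  moreover have "ent J (\<lambda>w. (fst (snd w), fst w)) = ent J (\<lambda>(t, x1, x2). (t, x1))"
    by (rule ent_cong) auto
  moreover have "ent J (\<lambda>w. (snd (snd w), fst w)) = ent J (\<lambda>(t, x1, x2). (t, x2))"
    by (rule ent_cong) auto
  ultimately show ?thesis using 1 2 by (simp add: cond_ent2_def field_simps)
qed

section \<open>Laws with conditionally independent inputs\<close>

definition kernel_law :: "'t pmf \<Rightarrow> ('t \<Rightarrow> nat pmf) \<Rightarrow> ('t \<Rightarrow> nat pmf) \<Rightarrow> ('t \<times> nat \<times> nat) pmf" where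
  "kernel_law pT p1 p2 = bind_pmf pT (\<lambda>t. map_pmf (Pair t) (pair_pmf (p1 t) (p2 t)))"

definition profile :: "('t \<times> nat \<times> nat) pmf \<Rightarrow> real \<times> real \<times> real \<times> real \<times> real" where
  "profile J = (mean1 J, mean2 J, mean12 J, cond_ent1 J, cond_ent2 J)"

text \<open>The profile of two independent bits with \<open>P(X1 = 1) = a\<close> and
  \<open>P(X2 = 1) = b\<close>, that is, the case of constant \<open>T\<close>.\<close>

definition corner :: "real \<times> real \<Rightarrow> real \<times> real \<times> real \<times> real \<times> real" where
  "corner = (\<lambda>(a, b). (a, b, a * b, eta a + eta (1 - a), eta b + eta (1 - b)))"

lemma ent_kernel:
  assumes pT: "finite (set_pmf pT)" and p: "\<And>t. t \<in> set_pmf pT \<Longrightarrow> set_pmf (p t) \<subseteq> bits"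
  shows "ent (bind_pmf pT (\<lambda>t. map_pmf (Pair t) (p t))) (\<lambda>w. w) - ent pT (\<lambda>t. t)
       = (\<Sum>t\<in>set_pmf pT. pmf pT t * (eta (pmf (p t) 1) + eta (1 - pmf (p t) 1)))"
proof -
  let ?K = "bind_pmf pT (\<lambda>t. map_pmf (Pair t) (p t))"
  have "ent ?K (\<lambda>w. w) = (\<Sum>w\<in>set_pmf pT \<times> bits. eta (pmf ?K w))"
    using pT p by (subst ent_eq_sum[of "set_pmf pT \<times> bits"]) (auto simp: bits_def)
  also have "\<dots> = (\<Sum>t\<in>set_pmf pT. \<Sum>x\<in>bits. eta (pmf ?K (t, x)))"
    by (simp add: sum.cartesian_product)
  also have "\<dots> = (\<Sum>t\<in>set_pmf pT. eta (pmf pT t) + pmf pT t * (eta (pmf (p t) 1) + eta (1 - pmf (p t) 1)))"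
  proof (rule sum.cong[OF refl])
    fix t assume t: "t \<in> set_pmf pT"
    have "(\<Sum>x\<in>bits. pmf (p t) x) = 1"
      using p[OF t] by (intro sum_pmf_eq_1) (auto simp: bits_def)
    then have 0: "pmf (p t) 0 = 1 - pmf (p t) 1" by (simp add: sum_bits)
    have "(\<Sum>x\<in>bits. eta (pmf ?K (t, x)))
      = eta (pmf pT t * pmf (p t) 0) + eta (pmf pT t * pmf (p t) 1)"
      by (simp add: sum_bits pmf_bind_map_Pair)
    also have "\<dots> = eta (pmf pT t) + pmf pT t * (eta (pmf (p t) 1) + eta (1 - pmf (p t) 1))"
      unfolding eta_mult 0 by (simp add: algebra_simps)
    finally show "(\<Sum>x\<in>bits. eta (pmf ?K (t, x))) = \<dots>" .
  qed
  also have "\<dots> = ent pT (\<lambda>t. t) + (\<Sum>t\<in>set_pmf pT. pmf pT t * (eta (pmf (p t) 1) + eta (1 - pmf (p t) 1)))"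
    using pT by (subst ent_eq_sum[of "set_pmf pT"]) (auto simp: sum.distrib)
  finally show ?thesis by simp
qed

lemma ent_map_id: "ent P X = ent (map_pmf X P) (\<lambda>w. w)"
  by (simp add: ent_map_pmf)

text \<open>All five numbers are averages over \<open>T\<close>: the means by total probability, the
  entropies because they are conditional on \<open>T\<close>. Conditional independence enters in the
  third coordinate, which is \<open>a * b\<close> at each value of \<open>T\<close>.\<close>

lemma profile_kernel_law:
  assumes pT: "finite (set_pmf pT)"
    and p: "\<And>t. t \<in> set_pmf pT \<Longrightarrow> set_pmf (p1 t) \<subseteq> bits \<and> set_pmf (p2 t) \<subseteq> bits"
  shows "profile (kernel_law pT p1 p2)
       = (\<Sum>t\<in>set_pmf pT. pmf pT t *\<^sub>R corner (pmf (p1 t) 1, pmf (p2 t) 1))"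
proof -
  let ?J = "kernel_law pT p1 p2"
  have e: "pmf (bind_pmf pT f) x = (\<Sum>t\<in>set_pmf pT. pmf pT t * pmf (f t) x)" for f :: "_ \<Rightarrow> 'b pmf" and x
    using pT by (subst pmf_bind, subst integral_measure_pmf_real[of "set_pmf pT"]) (auto simp: mult.commute)
  have X1: "map_pmf (\<lambda>(t, x1, x2). x1) ?J = bind_pmf pT p1"
    by (simp add: kernel_law_def map_bind_pmf map_pmf_comp map_fst_pair_pmf case_prod_unfold)
  have X2: "map_pmf (\<lambda>(t, x1, x2). x2) ?J = bind_pmf pT p2"
    by (simp add: kernel_law_def map_bind_pmf map_pmf_comp map_snd_pair_pmf case_prod_unfold)
  have X12: "map_pmf snd ?J = bind_pmf pT (\<lambda>t. pair_pmf (p1 t) (p2 t))"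
    by (simp add: kernel_law_def map_bind_pmf map_pmf_comp)
  have T: "map_pmf fst ?J = pT"
    by (simp add: kernel_law_def map_bind_pmf map_pmf_comp bind_return_pmf')
  have TX1: "map_pmf (\<lambda>(t, x1, x2). (t, x1)) ?J = bind_pmf pT (\<lambda>t. map_pmf (Pair t) (p1 t))"
  proof -
    have "map_pmf (Pair t) (p1 t) = map_pmf (\<lambda>w. (t, fst w)) (pair_pmf (p1 t) (p2 t))" for t
      using map_pmf_comp[of "Pair t" fst "pair_pmf (p1 t) (p2 t)"] by (simp add: map_fst_pair_pmf)
    then show ?thesis
      by (simp add: kernel_law_def map_bind_pmf map_pmf_comp case_prod_unfold)
  qed
  have TX2: "map_pmf (\<lambda>(t, x1, x2). (t, x2)) ?J = bind_pmf pT (\<lambda>t. map_pmf (Pair t) (p2 t))"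
  proof -
    have "map_pmf (Pair t) (p2 t) = map_pmf (\<lambda>w. (t, snd w)) (pair_pmf (p1 t) (p2 t))" for t
      using map_pmf_comp[of "Pair t" snd "pair_pmf (p1 t) (p2 t)"] by (simp add: map_snd_pair_pmf)
    then show ?thesis
      by (simp add: kernel_law_def map_bind_pmf map_pmf_comp case_prod_unfold)
  qed
  have u1: "cond_ent1 ?J = (\<Sum>t\<in>set_pmf pT. pmf pT t * (eta (pmf (p1 t) 1) + eta (1 - pmf (p1 t) 1)))"
    unfolding cond_ent1_def ent_map_id[of ?J fst] ent_map_id[of ?J "\<lambda>(t, x1, x2). (t, x1)"] T TX1
    using p by (intro ent_kernel[OF pT]) auto
  have u2: "cond_ent2 ?J = (\<Sum>t\<in>set_pmf pT. pmf pT t * (eta (pmf (p2 t) 1) + eta (1 - pmf (p2 t) 1)))"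
    unfolding cond_ent2_def ent_map_id[of ?J fst] ent_map_id[of ?J "\<lambda>(t, x1, x2). (t, x2)"] T TX2
    using p by (intro ent_kernel[OF pT]) auto
  show ?thesis
    by (simp add: profile_def mean1_def mean2_def mean12_def X1 X2 X12 u1 u2 e pmf_pair corner_def
        prod_eq_iff fst_sum snd_sum)
qed

lemma binary_law_kernel_law:
  assumes "finite (set_pmf pT)"
    and "\<And>t. t \<in> set_pmf pT \<Longrightarrow> set_pmf (p1 t) \<subseteq> bits \<and> set_pmf (p2 t) \<subseteq> bits"
  shows "binary_law (kernel_law pT p1 p2)"
proof -
  have sub: "set_pmf (kernel_law pT p1 p2) \<subseteq> set_pmf pT \<times> bits \<times> bits"
  proof
    fix w assume "w \<in> set_pmf (kernel_law pT p1 p2)"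
    then obtain t x1 x2 where w: "t \<in> set_pmf pT" "x1 \<in> set_pmf (p1 t)" "x2 \<in> set_pmf (p2 t)" "w = (t, x1, x2)"
      by (auto simp: kernel_law_def)
    with assms(2)[OF w(1)] show "w \<in> set_pmf pT \<times> bits \<times> bits" by auto
  qed
  moreover have "finite (set_pmf pT \<times> bits \<times> bits)" using assms(1) by (simp add: bits_def)
  ultimately show ?thesis
    unfolding binary_law_def using finite_subset by blast
qed

lemma chan_law_kernel_law: "chan_law (kernel_law pT p1 p2) = joint_pmf pT p1 p2"
  by (simp add: chan_law_def kernel_law_def joint_pmf_def pair_pmf_def bind_assoc_pmf bind_map_pmf
      bind_return_pmf map_bind_pmf)

section \<open>The single-letter region\<close>

text \<open>Only the point 0 needs work. The limit from the right is that of
  \<open>x * log 2 x\<close>; from the left it follows because \<open>ln\<close> is extended evenly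
  to negative arguments, which makes \<open>eta\<close> odd. Continuity on the whole line spares
  side conditions in the closedness arguments.\<close>

lemma continuous_on_eta [continuous_intros]:
  assumes "continuous_on S f"
  shows "continuous_on S (\<lambda>x. eta (f x))"
proof -
  have "isCont eta x" for x
  proof (cases "x = 0")
    case True
    have r: "(eta \<longlongrightarrow> 0) (at_right 0)" unfolding eta_def by real_asymp
    have l: "(eta \<longlongrightarrow> 0) (at_left 0)"
      unfolding filterlim_at_left_to_right
    proof -
      have "(\<lambda>x. eta (- x)) = (\<lambda>x. - eta x)" by (auto simp: eta_def log_def ln_minus)
      then show "((\<lambda>x. eta (- x)) \<longlongrightarrow> 0) (at_right (- 0))" using tendsto_minus[OF r] by simp
    qed
    show ?thesis using True filterlim_split_at[OF l r] by (simp add: isCont_def)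
  next
    case False
    then show ?thesis unfolding eta_def log_def by (intro continuous_intros) auto
  qed
  then have "continuous_on UNIV eta" by (simp add: continuous_on_eq_continuous_at)
  then show ?thesis by (rule continuous_on_compose2[OF _ assms]) simp
qed

section \<open>Concavity of the information functions\<close>

text \<open>The right side is the tangent plane at \<open>(S, Y)\<close> of the concave function
  \<open>x * ln (y / x)\<close>; it has no constant term because the function is homogeneous of
  degree one.\<close>

lemma perspective_le:
  fixes x y S Y :: real
  assumes "0 \<le> x" "x \<le> y" "0 < S" "0 < Y"
  shows "x * ln (y / x) \<le> x * ln (Y / S) + (y * S / Y - x)"
proof (cases "x = 0")
  case True
  then show ?thesis using assms by (simp add: zero_le_mult_iff zero_le_divide_iff)
next
  case False
  then have pos: "0 < x" "0 < y" using assms by auto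
  have "x * ln (y / x) - x * ln (Y / S) = x * ln (y * S / (x * Y))"
    using pos assms by (simp add: ln_div ln_mult algebra_simps)
  also have "\<dots> \<le> x * (y * S / (x * Y) - 1)"
    using pos assms by (intro mult_left_mono ln_le_minus_one) auto
  also have "\<dots> = y * S / Y - x" using pos by (simp add: field_simps)
  finally show ?thesis by simp
qed

text \<open>Add the tangent inequalities of both points at their sum; there the correction terms
  cancel.\<close>

lemma perspective_superadditive:
  fixes x1 y1 x2 y2 :: real
  assumes "0 \<le> x1" "x1 \<le> y1" "0 \<le> x2" "x2 \<le> y2"
  shows "x1 * ln (y1 / x1) + x2 * ln (y2 / x2) \<le> (x1 + x2) * ln ((y1 + y2) / (x1 + x2))"
proof (cases "x1 + x2 = 0")
  case True
  then have "x1 = 0" "x2 = 0" using assms by auto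
  then show ?thesis by simp
next
  case False
  then have pos: "0 < x1 + x2" "0 < y1 + y2" using assms by auto
  have "y1 * (x1 + x2) / (y1 + y2) + y2 * (x1 + x2) / (y1 + y2) = x1 + x2"
    using pos by (simp add: add_divide_distrib[symmetric] distrib_right[symmetric])
  then show ?thesis
    using perspective_le[OF assms(1,2) pos] perspective_le[OF assms(3,4) pos]
    by (simp add: algebra_simps)
qed

text \<open>Homogeneity turns superadditivity into concavity. The function is
  \<open>x * log 2 (y / x)\<close>: for \<open>y = 1\<close> it is \<open>eta\<close>, and for
  \<open>y\<close> the probability of a condition it is one term of a conditional entropy.\<close>

lemma perspective_concave:
  fixes x1 y1 x2 y2 :: real
  assumes "0 \<le> x1" "x1 \<le> y1" "0 \<le> x2" "x2 \<le> y2" "0 \<le> u" "0 \<le> v"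
  shows "u * (eta x1 + x1 * log 2 y1) + v * (eta x2 + x2 * log 2 y2)
       \<le> eta (u * x1 + v * x2) + (u * x1 + v * x2) * log 2 (u * y1 + v * y2)"
proof -
  have D: "eta x + x * log 2 y = x * ln (y / x) / ln 2" if "0 \<le> x" "x \<le> y" for x y
    using that by (cases "x = 0") (auto simp: eta_def log_def ln_div field_simps)
  have "u * x1 * ln (u * y1 / (u * x1)) + v * x2 * ln (v * y2 / (v * x2))
    \<le> (u * x1 + v * x2) * ln ((u * y1 + v * y2) / (u * x1 + v * x2))"
    using assms by (intro perspective_superadditive) (auto intro: mult_left_mono)
  moreover have "u * x1 * ln (u * y1 / (u * x1)) = u * (x1 * ln (y1 / x1))"
    "v * x2 * ln (v * y2 / (v * x2)) = v * (x2 * ln (y2 / x2))" by auto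
  ultimately have "u * (x1 * ln (y1 / x1)) + v * (x2 * ln (y2 / x2))
    \<le> (u * x1 + v * x2) * ln ((u * y1 + v * y2) / (u * x1 + v * x2))" by (simp only:)
  from divide_right_mono[OF this, of "ln 2"]
  have "u * (x1 * ln (y1 / x1)) / ln 2 + v * (x2 * ln (y2 / x2)) / ln 2
    \<le> (u * x1 + v * x2) * ln ((u * y1 + v * y2) / (u * x1 + v * x2)) / ln 2"
    by (simp add: add_divide_distrib)
  moreover have "u * x1 + v * x2 \<le> u * y1 + v * y2"
    using assms by (intro add_mono mult_left_mono) auto
  ultimately show ?thesis using assms by (simp add: D)
qed

lemma eta_concave:
  assumes "0 \<le> x" "x \<le> 1" "0 \<le> y" "y \<le> 1" "0 \<le> u" "0 \<le> v" "u + v = 1"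
  shows "u * eta x + v * eta y \<le> eta (u * x + v * y)"
  using perspective_concave[of x 1 y 1 u v] assms by simp

text \<open>The constraints say that the four cells \<open>c\<close>, \<open>a - c\<close>,
  \<open>b - c\<close>, \<open>1 - a - b + c\<close> of the joint law of two bits are nonnegative;
  the entropy coordinates are free. This is a convex domain on which the information functions are
  concave.\<close>

definition marginals :: "(real \<times> real \<times> real \<times> real \<times> real) set" where
  "marginals = {(a, b, c, u, w). 0 \<le> c \<and> c \<le> a \<and> c \<le> b \<and> a + b \<le> 1 + c}"

lemma convex_marginals: "convex marginals"
proof (rule convexI)
  fix x y :: "real \<times> real \<times> real \<times> real \<times> real" and u v :: real
  assume xy: "x \<in> marginals" "y \<in> marginals" and uv: "0 \<le> u" "0 \<le> v" "u + v = 1"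
  obtain a b c d e a' b' c' d' e' where x: "x = (a, b, c, d, e)" and y: "y = (a', b', c', d', e')"
    by (metis prod_cases5)
  have ineqs: "0 \<le> c" "c \<le> a" "c \<le> b" "a + b \<le> 1 + c" "0 \<le> c'" "c' \<le> a'" "c' \<le> b'" "a' + b' \<le> 1 + c'"
    using xy by (auto simp: x y marginals_def)
  have "u * (a + b) + v * (a' + b') \<le> u * (1 + c) + v * (1 + c')"
    using ineqs uv by (simp add: add_mono mult_left_mono)
  also have "\<dots> = (u + v) + (u * c + v * c')" by (simp add: algebra_simps)
  finally have "(u * a + v * a') + (u * b + v * b') \<le> 1 + (u * c + v * c')"
    using uv(3) by (simp add: algebra_simps)
  moreover have "u * c + v * c' \<le> u * a + v * a'" "u * c + v * c' \<le> u * b + v * b'"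
    using ineqs uv by (simp_all add: add_mono mult_left_mono)
  ultimately show "u *\<^sub>R x + v *\<^sub>R y \<in> marginals"
    using ineqs uv by (simp add: x y marginals_def)
qed

text \<open>Twice the function is \<open>H(X1 | X2)\<close>, a sum over the four cells of
  perspective terms whose arguments, a cell and a marginal of \<open>X2\<close>, are affine in
  \<open>(a, b, c)\<close>.\<close>

lemma concave_info_one: "concave_on marginals (\<lambda>(a, b, c, u, w). info_one a b c)"
  unfolding concave_on_iff
proof (intro conjI ballI allI impI convex_marginals)
  fix x y :: "real \<times> real \<times> real \<times> real \<times> real" and u v :: real
  assume xy: "x \<in> marginals" "y \<in> marginals" and uv: "0 \<le> u" "0 \<le> v" "u + v = 1"
  obtain a b c d e a' b' c' d' e' where x: "x = (a, b, c, d, e)" and y: "y = (a', b', c', d', e')"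
    by (metis prod_cases5)
  have ineqs: "0 \<le> c" "c \<le> a" "c \<le> b" "a + b \<le> 1 + c" "0 \<le> c'" "c' \<le> a'" "c' \<le> b'" "a' + b' \<le> 1 + c'"
    using xy by (auto simp: x y marginals_def)
  define f where "f = (\<lambda>q r. eta q + q * log 2 r)"
  have hI: "info_one a b c = (f (1 - a - b + c) (1 - b) + f (a - c) (1 - b) + f (b - c) b + f c b) / 2" for a b c
    by (simp add: info_one_def f_def eta_def algebra_simps)
  have f: "u * f p q + v * f p' q' \<le> f (u * p + v * p') (u * q + v * q')"
    if "0 \<le> p" "p \<le> q" "0 \<le> p'" "p' \<le> q'" for p q p' q'
    unfolding f_def using that uv by (intro perspective_concave) auto
  have v: "v = 1 - u" using uv(3) by simp
  have lin: "u * (1 - b) + v * (1 - b') = 1 - (u * b + v * b')"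
    "u * (1 - a - b + c) + v * (1 - a' - b' + c') = 1 - (u * a + v * a') - (u * b + v * b') + (u * c + v * c')"
    "u * (a - c) + v * (a' - c') = (u * a + v * a') - (u * c + v * c')"
    "u * (b - c) + v * (b' - c') = (u * b + v * b') - (u * c + v * c')"
    unfolding v by (simp_all add: algebra_simps)
  have "u * info_one a b c + v * info_one a' b' c' \<le> info_one (u * a + v * a') (u * b + v * b') (u * c + v * c')"
    unfolding hI
    using f[of "1 - a - b + c" "1 - b" "1 - a' - b' + c'" "1 - b'"] f[of "a - c" "1 - b" "a' - c'" "1 - b'"]
      f[of "b - c" b "b' - c'" b'] f[of c b c' b'] ineqs
    unfolding lin by (simp add: field_simps)
  then show "u * (case x of (a, b, c, u, w) \<Rightarrow> info_one a b c) + v * (case y of (a, b, c, u, w) \<Rightarrow> info_one a b c)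
      \<le> (case u *\<^sub>R x + v *\<^sub>R y of (a, b, c, u, w) \<Rightarrow> info_one a b c)"
    by (simp add: x y)
qed

text \<open>Up to the constant this is the entropy of the output, whose four probabilities are
  affine in \<open>(a, b, c)\<close>.\<close>

lemma concave_info_both: "concave_on marginals (\<lambda>(a, b, c, u, w). info_both a b c)"
  unfolding concave_on_iff
proof (intro conjI ballI allI impI convex_marginals)
  fix x y :: "real \<times> real \<times> real \<times> real \<times> real" and u v :: real
  assume xy: "x \<in> marginals" "y \<in> marginals" and uv: "0 \<le> u" "0 \<le> v" "u + v = 1"
  obtain a b c d e a' b' c' d' e' where x: "x = (a, b, c, d, e)" and y: "y = (a', b', c', d', e')"
    by (metis prod_cases5)
  have ineqs: "0 \<le> c" "c \<le> a" "c \<le> b" "a + b \<le> 1 + c" "0 \<le> c'" "c' \<le> a'" "c' \<le> b'" "a' + b' \<le> 1 + c'"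
    using xy by (auto simp: x y marginals_def)
  have v: "v = 1 - u" using uv(3) by simp
  have lin: "u * ((1 - a - b + c) / 2) + v * ((1 - a' - b' + c') / 2)
      = (1 - (u * a + v * a') - (u * b + v * b') + (u * c + v * c')) / 2"
    "u * ((1 - c) / 2) + v * ((1 - c') / 2) = (1 - (u * c + v * c')) / 2"
    "u * ((a + b - c) / 2) + v * ((a' + b' - c') / 2) = ((u * a + v * a') + (u * b + v * b') - (u * c + v * c')) / 2"
    "u * (c / 2) + v * (c' / 2) = (u * c + v * c') / 2"
    "u * 1 + v * 1 = (1::real)"
    unfolding v by (simp_all add: field_simps)
  have "u * info_both a b c + v * info_both a' b' c' \<le> info_both (u * a + v * a') (u * b + v * b') (u * c + v * c')"
    using eta_concave[of "(1 - a - b + c) / 2" "(1 - a' - b' + c') / 2" u v]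
      eta_concave[of "(1 - c) / 2" "(1 - c') / 2" u v]
      eta_concave[of "(a + b - c) / 2" "(a' + b' - c') / 2" u v]
      eta_concave[of "c / 2" "c' / 2" u v] ineqs uv
    unfolding lin info_both_def by (simp add: algebra_simps)
  then show "u * (case x of (a, b, c, u, w) \<Rightarrow> info_both a b c) + v * (case y of (a, b, c, u, w) \<Rightarrow> info_both a b c)
      \<le> (case u *\<^sub>R x + v *\<^sub>R y of (a, b, c, u, w) \<Rightarrow> info_both a b c)"
    by (simp add: x y)
qed

section \<open>Compactness of the profiles and closedness of the region\<close>

definition profiles :: "(real \<times> real \<times> real \<times> real \<times> real) set" where
  "profiles = convex hull (corner ` ({0..1} \<times> {0..1}))"

lemma compact_profiles: "compact profiles"
  unfolding profiles_def corner_def case_prod_unfold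
  by (intro compact_convex_hull compact_continuous_image continuous_intros compact_Times compact_Icc)

lemma profiles_subset_marginals: "profiles \<subseteq> marginals"
proof -
  \<comment> \<open>This is nonnegativity of the cell \<open>(1 - a) * (1 - b)\<close>.\<close>
  have "a + b \<le> 1 + a * b" if "a \<le> 1" "b \<le> 1" for a b :: real
    using mult_nonneg_nonneg[of "1 - a" "1 - b"] that by (simp add: algebra_simps)
  then show ?thesis
    unfolding profiles_def
    by (intro hull_minimal convex_marginals)
      (auto simp: corner_def marginals_def intro: mult_left_le mult_left_le_one_le)
qed

text \<open>Nonnegativity of the rates is left out, because the rate of a code less Fano's slack may
  be negative; it returns as a hypothesis of \<open>outer_region_DB\<close>.\<close>

definition admits :: "real \<times> real \<times> real \<times> real \<times> real \<Rightarrow> real \<times> real \<Rightarrow> bool" where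
  "admits = (\<lambda>(a, b, c, u, w) (R1, R2).
     R1 \<le> info_one a b c \<and> R1 \<le> u \<and> R2 \<le> w / 2 \<and> R1 + R2 \<le> info_both a b c)"

definition outer_region :: "(real \<times> real) set" where
  "outer_region = {R. \<exists>v. v \<in> profiles \<and> admits v R}"

text \<open>The region is the projection of a closed set along a compact factor.\<close>

lemma closed_outer_region: "closed outer_region"
proof -
  have "closed {p. admits (fst p) (snd p)}"
    unfolding admits_def case_prod_unfold info_one_def info_both_def
    by (intro closed_Collect_conj closed_Collect_le continuous_intros) auto
  then have "closed {p. case p of (v, R) \<Rightarrow> admits v R}" by (simp add: case_prod_unfold)
  from closed_compact_projection[OF compact_profiles this]
  show ?thesis unfolding outer_region_def by simp
qed

section \<open>From a profile back to a law with few values of \<open>T\<close>\<close>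

definition bit_pmf :: "real \<Rightarrow> nat pmf" where
  "bit_pmf a = map_pmf of_bool (bernoulli_pmf a)"

lemma pmf_bit_pmf_1: "0 \<le> a \<Longrightarrow> a \<le> 1 \<Longrightarrow> pmf (bit_pmf a) 1 = a"
  using pmf_map_inj'[of "of_bool :: bool \<Rightarrow> nat" "bernoulli_pmf a" True]
  by (simp add: bit_pmf_def inj_on_def)

lemma set_pmf_bit_pmf: "set_pmf (bit_pmf a) \<subseteq> bits"
  by (auto simp: bit_pmf_def bits_def)

lemma profiles_kernel_law:
  assumes "v \<in> profiles"
  obtains pT :: "nat pmf" and p1 p2 where "finite (set_pmf pT)" "card (set_pmf pT) \<le> 7"
    "\<And>t. set_pmf (p1 t) \<subseteq> bits" "\<And>t. set_pmf (p2 t) \<subseteq> bits" "profile (kernel_law pT p1 p2) = v"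
proof -
  \<comment> \<open>The profiles live in dimension 5, hence six points.\<close>
  obtain S where S: "finite S" "S \<subseteq> corner ` ({0..1} \<times> {0..1})" "card S \<le> 6" "v \<in> convex hull S"
    using assms unfolding profiles_def by (subst (asm) caratheodory) auto
  then obtain u where u: "\<And>s. s \<in> S \<Longrightarrow> 0 \<le> u s" "sum u S = 1" "(\<Sum>s\<in>S. u s *\<^sub>R s) = v"
    by (auto simp: convex_hull_finite)
  obtain h where h: "bij_betw h {0..<card S} S" using ex_bij_betw_nat_finite[OF S(1)] by blast
  define f where "f = (\<lambda>i. if i < card S then u (h i) else 0)"
  have hS: "h i \<in> S" if "i < card S" for i using h that by (auto simp: bij_betw_def)
  have f0: "0 \<le> f i" for i by (simp add: f_def u(1) hS)
  have "(\<Sum>i\<in>{0..<card S}. f i) = 1"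
    using sum.reindex_bij_betw[OF h, of u] u(2) by (simp add: f_def)
  then have f1: "(\<integral>\<^sup>+ i. ennreal (f i) \<partial>count_space UNIV) = 1"
    by (subst nn_integral_count_space'[of "{0..<card S}"]) (simp_all add: sum_ennreal f0, simp add: f_def)
  define pT where "pT = embed_pmf f"
  have pT: "pmf pT i = f i" for i unfolding pT_def by (rule pmf_embed_pmf[OF f0 f1])
  have supp: "set_pmf pT \<subseteq> {0..<card S}" by (auto simp: set_pmf_eq pT f_def)
  then have fin: "finite (set_pmf pT)" by (rule finite_subset) simp
  have card: "card (set_pmf pT) \<le> 7" using card_mono[OF _ supp] S(3) by simp
  \<comment> \<open>\<open>T\<close> is the number of a point of \<open>S\<close>; the first two
    coordinates of a corner are its parameters.\<close>
  define p1 where "p1 = (\<lambda>i. bit_pmf (fst (h i)))"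
  define p2 where "p2 = (\<lambda>i. bit_pmf (fst (snd (h i))))"
  have corner: "corner (pmf (p1 i) 1, pmf (p2 i) 1) = h i" if i: "i < card S" for i
  proof -
    obtain a b where ab: "0 \<le> a" "a \<le> 1" "0 \<le> b" "b \<le> 1" "h i = corner (a, b)"
      using hS[OF i] S(2) by fastforce
    then have "pmf (p1 i) 1 = a" "pmf (p2 i) 1 = b"
      using pmf_bit_pmf_1 by (simp_all add: p1_def p2_def corner_def)
    then show ?thesis using ab by simp
  qed
  have "profile (kernel_law pT p1 p2) = (\<Sum>t\<in>set_pmf pT. pmf pT t *\<^sub>R corner (pmf (p1 t) 1, pmf (p2 t) 1))"
    by (rule profile_kernel_law[OF fin]) (simp add: p1_def p2_def set_pmf_bit_pmf)
  \<comment> \<open>Some weights may be zero, so the support can be smaller than the index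
    set.\<close>
  also have "\<dots> = (\<Sum>t\<in>{0..<card S}. pmf pT t *\<^sub>R corner (pmf (p1 t) 1, pmf (p2 t) 1))"
    using supp by (intro sum.mono_neutral_left) (auto simp: set_pmf_eq)
  also have "\<dots> = (\<Sum>t\<in>{0..<card S}. u (h t) *\<^sub>R h t)"
    by (intro sum.cong refl) (simp add: corner[unfolded One_nat_def] corner pT f_def)
  also have "\<dots> = v" using sum.reindex_bij_betw[OF h, of "\<lambda>s. u s *\<^sub>R s"] u(3) by simp
  finally show ?thesis
    using fin card by (intro that[of pT p1 p2]) (auto simp: p1_def p2_def set_pmf_bit_pmf[THEN subsetD])
qed

text \<open>After expansion into joint entropies, \<open>H(X1, X2, Y) = H(X1, X2) + 1\<close> leaves
  an output entropy less the noise bit in each mutual information.\<close>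

lemma information_chan_law:
  fixes J :: "(nat \<times> nat \<times> nat) pmf"
  assumes J: "binary_law J"
  shows "cond_entropy (chan_law J) rv_X1 rv_T = cond_ent1 J"
    and "cond_entropy (chan_law J) rv_X2 rv_T = cond_ent2 J"
    and "cond_mutual_info (chan_law J) rv_X1 rv_Y rv_X2 = info_one (mean1 J) (mean2 J) (mean12 J)"
    and "cond_mutual_info (chan_law J) rv_X2 rv_Y rv_X1 = info_one (mean2 J) (mean1 J) (mean12 J)"
    and "mutual_info (chan_law J) (\<lambda>\<omega>. (rv_X1 \<omega>, rv_X2 \<omega>)) rv_Y = info_both (mean1 J) (mean2 J) (mean12 J)"
proof -
  let ?P = "chan_law J"
  have P: "finite (set_pmf ?P)" using J by (auto simp: binary_law_def intro: finite_set_pmf_chan_law)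
  have T: "ent ?P rv_T = ent J fst"
    using ent_chan_law[of J "\<lambda>t x1 x2. t"] by (simp add: rv_T_def case_prod_unfold)
  have X1: "ent ?P rv_X1 = ent J (\<lambda>(t, x1, x2). x1)"
    using ent_chan_law[of J "\<lambda>t x1 x2. x1"] by (simp add: rv_X1_def)
  have X2: "ent ?P rv_X2 = ent J (\<lambda>(t, x1, x2). x2)"
    using ent_chan_law[of J "\<lambda>t x1 x2. x2"] by (simp add: rv_X2_def)
  have X1T: "ent ?P (\<lambda>\<omega>. (rv_X1 \<omega>, rv_T \<omega>)) = ent J (\<lambda>(t, x1, x2). (t, x1))"
    unfolding ent_chan_law[of J "\<lambda>t x1 x2. (t, x1)", symmetric]
    by (rule ent_cong) (auto simp: rv_X1_def rv_T_def)
  have X2T: "ent ?P (\<lambda>\<omega>. (rv_X2 \<omega>, rv_T \<omega>)) = ent J (\<lambda>(t, x1, x2). (t, x2))"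
    unfolding ent_chan_law[of J "\<lambda>t x1 x2. (t, x2)", symmetric]
    by (rule ent_cong) (auto simp: rv_X2_def rv_T_def)
  have "ent J snd = ent J (\<lambda>(t, x1, x2). (x1, x2))" by (rule ent_cong) auto
  then have J12: "ent J snd = ent ?P (\<lambda>(t, x1, x2, y). (x1, x2))"
    unfolding ent_chan_law[of J "\<lambda>t x1 x2. (x1, x2)"] .
  have X12: "ent ?P (\<lambda>\<omega>. (rv_X1 \<omega>, rv_X2 \<omega>)) = ent J snd" "ent ?P (\<lambda>\<omega>. (rv_X2 \<omega>, rv_X1 \<omega>)) = ent J snd"
    unfolding J12 by (rule ent_cong; auto simp: rv_X1_def rv_X2_def)+
  have X12Y: "ent ?P (\<lambda>\<omega>. (rv_X1 \<omega>, rv_Y \<omega>, rv_X2 \<omega>)) = ent J snd + 1"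
    "ent ?P (\<lambda>\<omega>. (rv_X2 \<omega>, rv_Y \<omega>, rv_X1 \<omega>)) = ent J snd + 1"
    "ent ?P (\<lambda>\<omega>. ((rv_X1 \<omega>, rv_X2 \<omega>), rv_Y \<omega>)) = ent J snd + 1"
    unfolding ent_chan_law_inputs_output[OF J, symmetric]
    by (rule ent_cong; auto simp: rv_X1_def rv_X2_def rv_Y_def)+
  have YX2: "ent ?P (\<lambda>\<omega>. (rv_Y \<omega>, rv_X2 \<omega>)) = ent ?P (\<lambda>(t, x1, x2, y). (x2, y))"
    by (rule ent_cong) (auto simp: rv_X2_def rv_Y_def)
  have YX1: "ent ?P (\<lambda>\<omega>. (rv_Y \<omega>, rv_X1 \<omega>)) = ent ?P (\<lambda>(t, x1, x2, y). (x1, y))"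
    by (rule ent_cong) (auto simp: rv_X1_def rv_Y_def)
  show "cond_entropy ?P rv_X1 rv_T = cond_ent1 J" "cond_entropy ?P rv_X2 rv_T = cond_ent2 J"
    by (simp_all add: cond_entropy_eq_ent[OF P] X1T X2T T cond_ent1_def cond_ent2_def)
  show "cond_mutual_info ?P rv_X1 rv_Y rv_X2 = info_one (mean1 J) (mean2 J) (mean12 J)"
    using ent_output_given_input2[OF J] by (simp add: cond_mutual_info_eq_ent[OF P] X12 X12Y X2 YX2)
  show "cond_mutual_info ?P rv_X2 rv_Y rv_X1 = info_one (mean2 J) (mean1 J) (mean12 J)"
    using ent_output_given_input1[OF J] by (simp add: cond_mutual_info_eq_ent[OF P] X12 X12Y X1 YX1)
  show "mutual_info ?P (\<lambda>\<omega>. (rv_X1 \<omega>, rv_X2 \<omega>)) rv_Y = info_both (mean1 J) (mean2 J) (mean12 J)"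
    using ent_output[OF J] unfolding mutual_info_eq_ent[OF P] X12 X12Y by (simp add: rv_Y_def)
qed

lemma swap_kernel_law: "swap_law (kernel_law pT p1 p2) = kernel_law pT p2 p1"
  unfolding swap_law_def kernel_law_def
  by (subst (2) pair_commute_pmf) (simp add: map_bind_pmf map_pmf_comp case_prod_unfold)

lemma cond_ent_swap [simp]: "cond_ent1 (swap_law J) = cond_ent2 J" "cond_ent2 (swap_law J) = cond_ent1 J"
  by (simp_all add: cond_ent1_def cond_ent2_def ent_swap_law case_prod_unfold)

lemma info_both_commute: "info_both a b c = info_both b a c"
  by (simp add: info_both_def algebra_simps)

text \<open>For \<open>DB2\<close> the two kernels are exchanged, which exchanges the roles of all
  quantities while the sum bound is symmetric.\<close>

lemma outer_region_DB:
  assumes "(R1, R2) \<in> outer_region" "0 \<le> R1" "0 \<le> R2"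
  shows "(R1, R2) \<in> DB1" and "(R2, R1) \<in> DB2"
proof -
  obtain v where v: "v \<in> profiles" "admits v (R1, R2)" using assms(1) by (auto simp: outer_region_def)
  obtain pT :: "nat pmf" and p1 p2 where p: "finite (set_pmf pT)" "card (set_pmf pT) \<le> 7"
    "\<And>t. set_pmf (p1 t) \<subseteq> bits" "\<And>t. set_pmf (p2 t) \<subseteq> bits" "profile (kernel_law pT p1 p2) = v"
    by (rule profiles_kernel_law[OF v(1)]) blast
  let ?J = "kernel_law pT p1 p2"
  have J: "binary_law ?J" using p by (intro binary_law_kernel_law) auto
  have in1: "chan_law ?J \<in> input_laws" and in2: "chan_law (swap_law ?J) \<in> input_laws"
    unfolding swap_kernel_law chan_law_kernel_law input_laws_def using p by blast+
  have R: "R1 \<le> info_one (mean1 ?J) (mean2 ?J) (mean12 ?J)" "R1 \<le> cond_ent1 ?J" "R2 \<le> cond_ent2 ?J / 2"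
    "R1 + R2 \<le> info_both (mean1 ?J) (mean2 ?J) (mean12 ?J)"
    using v(2) unfolding p(5)[symmetric] profile_def admits_def by auto
  show "(R1, R2) \<in> DB1"
    unfolding DB1_def using R assms(2,3)
    by (intro UN_I[OF in1]) (simp add: information_chan_law[OF J])
  show "(R2, R1) \<in> DB2"
    unfolding DB2_def using R assms(2,3)
    by (intro UN_I[OF in2])
      (simp add: information_chan_law[OF binary_law_swap[OF J]] info_both_commute[of "mean2 _"] add.commute)
qed

section \<open>Feedback codes\<close>

lemma profile_kernel_law_in_profiles:
  assumes pT: "finite (set_pmf pT)"
    and p: "\<And>t. t \<in> set_pmf pT \<Longrightarrow> set_pmf (p1 t) \<subseteq> bits \<and> set_pmf (p2 t) \<subseteq> bits"
  shows "profile (kernel_law pT p1 p2) \<in> profiles"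
proof -
  have "(\<Sum>t\<in>set_pmf pT. pmf pT t *\<^sub>R corner (pmf (p1 t) 1, pmf (p2 t) 1)) \<in> profiles"
    unfolding profiles_def
  proof (rule convex_sum[OF pT convex_convex_hull])
    show "(\<Sum>t\<in>set_pmf pT. pmf pT t) = 1" using pT by (intro sum_pmf_eq_1) auto
    show "corner (pmf (p1 t) 1, pmf (p2 t) 1) \<in> convex hull (corner ` ({0..1} \<times> {0..1}))" for t
      by (intro hull_inc imageI) (simp add: pmf_le_1)
  qed simp
  then show ?thesis using profile_kernel_law[OF pT p] by simp
qed

section \<open>The law of messages and outputs of a code\<close>

lemma length_output_pmf: "ys \<in> set_pmf (output_pmf W e1 e2 w1 w2 i) \<Longrightarrow> length ys = i"
  by (induction i arbitrary: ys) auto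

text \<open>Causality: later uses do not alter the law of earlier outputs, so quantities at time
  \<open>i\<close> may be computed in a shorter block.\<close>

lemma map_take_output_pmf:
  assumes "i \<le> k"
  shows "map_pmf (take i) (output_pmf W e1 e2 w1 w2 k) = output_pmf W e1 e2 w1 w2 i"
  using assms
proof (induction k rule: dec_induct)
  case base
  have "map_pmf (take i) (output_pmf W e1 e2 w1 w2 i) = map_pmf (\<lambda>ys. ys) (output_pmf W e1 e2 w1 w2 i)"
    by (intro map_pmf_cong refl) (auto dest: length_output_pmf)
  then show ?case by simp
next
  case (step k)
  have "map_pmf (take i) (output_pmf W e1 e2 w1 w2 (Suc k))
      = bind_pmf (output_pmf W e1 e2 w1 w2 k) (\<lambda>ys. return_pmf (take i ys))"
    unfolding output_pmf.simps map_bind_pmf map_pmf_comp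
    using step.hyps by (intro bind_pmf_cong refl) (auto dest: length_output_pmf simp: map_pmf_const)
  also have "\<dots> = map_pmf (take i) (output_pmf W e1 e2 w1 w2 k)" by (simp add: map_pmf_def)
  finally show ?case using step.IH by simp
qed

text \<open>The support condition for an output word. Positions count from 0, so the encoders at
  time \<open>Suc j\<close> see the first \<open>j\<close> outputs.\<close>

definition consistent :: "(nat \<Rightarrow> nat \<Rightarrow> nat list \<Rightarrow> nat) \<Rightarrow> (nat \<Rightarrow> nat \<Rightarrow> nat list \<Rightarrow> nat) \<Rightarrow>
    nat \<Rightarrow> nat \<Rightarrow> nat list \<Rightarrow> bool" where
  "consistent e1 e2 w1 w2 ys \<longleftrightarrow> (\<forall>j<length ys.
     ys ! j \<in> set_pmf (ban_channel (e1 (Suc j) w1 (take j ys)) (e2 (Suc j) w2 (take j ys))))"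

lemma consistent_snoc: "consistent e1 e2 w1 w2 (ys @ [y]) \<longleftrightarrow> consistent e1 e2 w1 w2 ys \<and>
   y \<in> set_pmf (ban_channel (e1 (Suc (length ys)) w1 ys) (e2 (Suc (length ys)) w2 ys))"
  by (simp add: consistent_def All_less_Suc nth_append conj_commute)

text \<open>Whatever the inputs, the channel is uniform on two outputs, so each use contributes a
  factor \<open>1 / 2\<close>.\<close>

lemma pmf_output_pmf:
  "pmf (output_pmf ban_channel e1 e2 w1 w2 i) ys
     = (if length ys = i \<and> consistent e1 e2 w1 w2 ys then (1 / 2) ^ i else 0)"
proof (induction i arbitrary: ys)
  case 0
  then show ?case by (auto simp: consistent_def)
next
  case (Suc i)
  show ?case
  proof (cases ys rule: rev_cases)
    case Nil
    then have "ys \<notin> set_pmf (output_pmf ban_channel e1 e2 w1 w2 (Suc i))"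
      using length_output_pmf by fastforce
    then show ?thesis using Nil by (simp add: set_pmf_eq)
  next
    case (snoc zs z)
    show ?thesis
      unfolding snoc output_pmf.simps pmf_bind_map_snoc Suc.IH consistent_snoc
      by (auto simp: pmf_ban_channel set_pmf_ban_channel_eq)
  qed
qed

locale feedback_code =
  fixes n M1 M2 :: nat and e1 e2 :: "nat \<Rightarrow> nat \<Rightarrow> nat list \<Rightarrow> nat"
  assumes M1: "1 \<le> M1" and M2: "1 \<le> M2"
    and enc1: "is_encoder bits ban_outputs n M1 e1"
    and enc2: "is_encoder bits ban_outputs n M2 e2"
begin

definition code_law :: "nat \<Rightarrow> ((nat \<times> nat) \<times> nat list) pmf" where
  "code_law i = message_output_pmf ban_channel i M1 M2 e1 e2"

text \<open>Times count from 0 from here on: index \<open>j\<close> belongs to channel use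
  \<open>Suc j\<close>.\<close>

definition input1 :: "nat \<Rightarrow> (nat \<times> nat) \<times> nat list \<Rightarrow> nat" where
  "input1 j \<omega> = e1 (Suc j) (fst (fst \<omega>)) (take j (snd \<omega>))"

definition input2 :: "nat \<Rightarrow> (nat \<times> nat) \<times> nat list \<Rightarrow> nat" where
  "input2 j \<omega> = e2 (Suc j) (snd (fst \<omega>)) (take j (snd \<omega>))"

definition received :: "nat \<Rightarrow> (nat \<times> nat) \<times> nat list \<Rightarrow> nat" where
  "received j \<omega> = snd \<omega> ! j"

definition past :: "nat \<Rightarrow> (nat \<times> nat) \<times> nat list \<Rightarrow> nat list \<times> nat list" where
  "past i \<omega> = (map (\<lambda>j. input1 j \<omega>) [0..<i], take i (snd \<omega>))"

abbreviation msgs :: "(nat \<times> nat) set" where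
  "msgs \<equiv> {1..M1} \<times> {1..M2}"

lemma pmf_code_law: "pmf (code_law i) ((w1, w2), ys) =
   (if (w1, w2) \<in> msgs \<and> length ys = i \<and> consistent e1 e2 w1 w2 ys
    then (1 / 2) ^ i / (real M1 * real M2) else 0)"
proof -
  have "code_law i = bind_pmf (pair_pmf (pmf_of_set {1..M1}) (pmf_of_set {1..M2}))
     (\<lambda>w. map_pmf (Pair w) (output_pmf ban_channel e1 e2 (fst w) (snd w) i))"
    by (simp add: code_law_def message_output_pmf_def case_prod_unfold)
  then show ?thesis
    using M1 M2 by (auto simp: pmf_bind_map_Pair pmf_pair pmf_output_pmf)
qed

lemma code_law_Suc: "code_law (Suc i) = bind_pmf (code_law i) (\<lambda>(w, ys). map_pmf (\<lambda>y. (w, ys @ [y]))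
    (ban_channel (e1 (Suc i) (fst w) ys) (e2 (Suc i) (snd w) ys)))"
  by (simp add: code_law_def message_output_pmf_def map_bind_pmf bind_assoc_pmf bind_map_pmf map_pmf_comp case_prod_unfold)

lemma map_take_code_law: "i \<le> k \<Longrightarrow> map_pmf (\<lambda>\<omega>. (fst \<omega>, take i (snd \<omega>))) (code_law k) = code_law i"
  by (simp add: code_law_def message_output_pmf_def map_bind_pmf map_pmf_comp case_prod_unfold
      map_take_output_pmf[symmetric, of i k])

lemma code_law_support:
  assumes "\<omega> \<in> set_pmf (code_law i)"
  shows "fst \<omega> \<in> msgs" "length (snd \<omega>) = i" "consistent e1 e2 (fst (fst \<omega>)) (snd (fst \<omega>)) (snd \<omega>)"
proof -
  obtain w1 w2 ys where \<omega>: "\<omega> = ((w1, w2), ys)" by (metis prod.exhaust)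
  have "pmf (code_law i) ((w1, w2), ys) \<noteq> 0" using assms by (simp add: \<omega> set_pmf_iff)
  then show "fst \<omega> \<in> msgs" "length (snd \<omega>) = i" "consistent e1 e2 (fst (fst \<omega>)) (snd (fst \<omega>)) (snd \<omega>)"
    unfolding pmf_code_law by (auto simp: \<omega> split: if_splits)
qed

lemma encoder_bits:
  assumes "(w1, w2) \<in> msgs" "j < n" "length ys = j" "set ys \<subseteq> ban_outputs"
  shows "e1 (Suc j) w1 ys \<in> bits" "e2 (Suc j) w2 ys \<in> bits"
  using enc1 enc2 assms unfolding is_encoder_def words_def by force+

text \<open>The encoders are constrained only on words over \<open>ban_outputs\<close>, so inputs
  and outputs have to be kept in range together by induction on time.\<close>

lemma code_law_outputs: "i \<le> n \<Longrightarrow> \<omega> \<in> set_pmf (code_law i) \<Longrightarrow> set (snd \<omega>) \<subseteq> ban_outputs"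
proof (induction i arbitrary: \<omega>)
  case 0
  then show ?case using code_law_support(2)[of \<omega> 0] by simp
next
  case (Suc i)
  then obtain w1 w2 ys y where \<omega>: "((w1, w2), ys) \<in> set_pmf (code_law i)" "\<omega> = ((w1, w2), ys @ [y])"
      "y \<in> set_pmf (ban_channel (e1 (Suc i) w1 ys) (e2 (Suc i) w2 ys))"
    unfolding code_law_Suc by fastforce
  have ys: "set ys \<subseteq> ban_outputs" using Suc.IH[OF _ \<omega>(1)] Suc.prems(1) by simp
  have "(w1, w2) \<in> msgs" "length ys = i" using code_law_support(1,2)[OF \<omega>(1)] by auto
  from encoder_bits[OF this(1) _ this(2) ys] Suc.prems(1)
  have "y \<in> ban_outputs" using set_pmf_ban_channel \<omega>(3) by fastforce
  then show ?case using ys \<omega>(2) by simp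
qed

lemma finite_code_law: assumes "i \<le> n" shows "finite (set_pmf (code_law i))"
proof (rule finite_subset)
  show "set_pmf (code_law i) \<subseteq> msgs \<times> {ys. set ys \<subseteq> ban_outputs \<and> length ys = i}"
    using code_law_support(1,2)[of _ i] code_law_outputs[OF assms] by (simp add: subset_eq mem_Times_iff)
  show "finite (msgs \<times> {ys. set ys \<subseteq> ban_outputs \<and> length ys = i})"
    by (intro finite_cartesian_product finite_lists_length_eq) (auto simp: ban_outputs_def)
qed

section \<open>Conditional independence given the past\<close>

definition compat1 :: "nat list \<times> nat list \<Rightarrow> nat set" where
  "compat1 = (\<lambda>(xs, ys). {w1 \<in> {1..M1}. map (\<lambda>j. e1 (Suc j) w1 (take j ys)) [0..<length ys] = xs})"

text \<open>The inputs of user 1 are read from the recorded \<open>xs\<close> and not computed from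
  \<open>w1\<close>. This decouples the condition on \<open>w2\<close> from the first
  message.\<close>

definition compat2 :: "nat list \<times> nat list \<Rightarrow> nat set" where
  "compat2 = (\<lambda>(xs, ys). {w2 \<in> {1..M2}. \<forall>j<length ys.
      ys ! j \<in> set_pmf (ban_channel (xs ! j) (e2 (Suc j) w2 (take j ys)))})"

text \<open>Given the past inputs of user 1 and the past outputs, the two messages are independent: each
  past output restricts only the message of user 2, and each past input only that of user 1.\<close>

lemma pmf_past:
  "pmf (map_pmf (\<lambda>\<omega>. (fst \<omega>, past i \<omega>)) (code_law i)) ((w1, w2), t)
     = (if length (snd t) = i \<and> w1 \<in> compat1 t \<and> w2 \<in> compat2 t
        then (1 / 2) ^ i / (real M1 * real M2) else 0)"
proof -
  obtain xs ys where t: "t = (xs, ys)" by (cases t)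
  let ?xs = "map (\<lambda>j. e1 (Suc j) w1 (take j ys)) [0..<i]"
  have past: "past i ((w1, w2), ys) = (?xs, ys)" if "length ys = i"
    using that by (auto simp: past_def input1_def)
  show ?thesis
  proof (cases "length ys = i \<and> xs = ?xs")
    case True
    have "pmf (map_pmf (\<lambda>\<omega>. (fst \<omega>, past i \<omega>)) (code_law i)) ((w1, w2), t)
        = measure_pmf.prob (code_law i) {((w1, w2), ys)}"
      unfolding pmf_map
    proof (rule measure_pmf.finite_measure_eq_AE)
      show "AE \<omega> in measure_pmf (code_law i). (\<omega> \<in> (\<lambda>\<omega>. (fst \<omega>, past i \<omega>)) -` {((w1, w2), t)}) = (\<omega> \<in> {((w1, w2), ys)})"
      proof (subst AE_measure_pmf_iff, intro ballI)
        fix \<omega> assume "\<omega> \<in> set_pmf (code_law i)"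
        then have "length (snd \<omega>) = i" by (rule code_law_support)
        then show "(\<omega> \<in> (\<lambda>\<omega>. (fst \<omega>, past i \<omega>)) -` {((w1, w2), t)}) = (\<omega> \<in> {((w1, w2), ys)})"
          using True past by (cases \<omega>) (auto simp: t past_def)
      qed
    qed auto
    also have "\<dots> = pmf (code_law i) ((w1, w2), ys)" by (rule measure_pmf_single)
    also have "\<dots> = (if length (snd t) = i \<and> w1 \<in> compat1 t \<and> w2 \<in> compat2 t
        then (1 / 2) ^ i / (real M1 * real M2) else 0)"
      using True by (auto simp: pmf_code_law t compat1_def compat2_def consistent_def)
    finally show ?thesis .
  next
    case False
    have "((w1, w2), t) \<notin> (\<lambda>\<omega>. (fst \<omega>, past i \<omega>)) ` set_pmf (code_law i)"
    proof
      assume "((w1, w2), t) \<in> (\<lambda>\<omega>. (fst \<omega>, past i \<omega>)) ` set_pmf (code_law i)"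
      then obtain \<omega> where "\<omega> \<in> set_pmf (code_law i)" "fst \<omega> = (w1, w2)" "past i \<omega> = t" by auto
      then show False using False code_law_support(2)[of \<omega> i] past by (cases \<omega>) (auto simp: t past_def)
    qed
    then show ?thesis
      using False by (subst pmf_map_outside) (auto simp: t compat1_def)
  qed
qed

lemma finite_compat: "finite (compat1 t)" "finite (compat2 t)"
  by (auto simp: compat1_def compat2_def split: prod.split)

lemma compat_subset: "compat1 t \<subseteq> {1..M1}" "compat2 t \<subseteq> {1..M2}"
  by (auto simp: compat1_def compat2_def split: prod.split)

lemma pmf_past_marginal:
  assumes "i \<le> n"
  shows "pmf (map_pmf (past i) (code_law i)) t
     = (if length (snd t) = i then (1 / 2) ^ i / (real M1 * real M2) * (card (compat1 t) * card (compat2 t)) else 0)"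
proof -
  have "pmf (map_pmf (past i) (code_law i)) t
      = (\<Sum>w\<in>msgs. pmf (map_pmf (\<lambda>\<omega>. (fst \<omega>, past i \<omega>)) (code_law i)) (w, t))"
    using code_law_support(1) by (intro sum_pmf_map_Pair[symmetric]) auto
  also have "\<dots> = (\<Sum>w\<in>compat1 t \<times> compat2 t.
      if length (snd t) = i then (1 / 2) ^ i / (real M1 * real M2) else 0)"
    using compat_subset[of t] by (intro sum.mono_neutral_cong_right) (auto simp: pmf_past split: if_splits)
  finally show ?thesis by (simp add: card_cartesian_product)
qed

text \<open>The joint probability is constant on \<open>compat1 t \<times> compat2 t\<close>, and a
  uniform law on a product set is a product of uniform laws.\<close>

lemma past_law_kernel:
  assumes i: "i \<le> n"
  shows "map_pmf (\<lambda>\<omega>. (past i \<omega>, fst \<omega>)) (code_law i) = bind_pmf (map_pmf (past i) (code_law i))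
    (\<lambda>t. map_pmf (Pair t) (pair_pmf (pmf_of_set (compat1 t)) (pmf_of_set (compat2 t))))"
proof (rule pmf_eqI)
  fix tw :: "(nat list \<times> nat list) \<times> nat \<times> nat"
  obtain t w1 w2 where tw: "tw = (t, w1, w2)" by (cases tw)
  have "pmf (map_pmf (\<lambda>\<omega>. (past i \<omega>, fst \<omega>)) (code_law i)) (t, w1, w2)
      = pmf (map_pmf (\<lambda>\<omega>. (fst \<omega>, past i \<omega>)) (code_law i)) ((w1, w2), t)"
    by (auto simp: pmf_map intro!: arg_cong[where f = "measure_pmf.prob (code_law i)"])
  also have "\<dots> = pmf (map_pmf (past i) (code_law i)) t
      * (pmf (pmf_of_set (compat1 t)) w1 * pmf (pmf_of_set (compat2 t)) w2)"
  \<comment> \<open>\<open>pmf_of_set\<close> is unspecified on the empty set, but such a past has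
    probability 0 and both sides vanish.\<close>
  proof (cases "compat1 t = {} \<or> compat2 t = {}")
    case True
    then show ?thesis by (auto simp: pmf_past pmf_past_marginal[OF i])
  next
    case False
    then have "card (compat1 t) \<noteq> 0" "card (compat2 t) \<noteq> 0" using finite_compat by auto
    then show ?thesis using False finite_compat[of t]
      by (simp add: pmf_past pmf_past_marginal[OF i] indicator_def)
  qed
  finally show "pmf (map_pmf (\<lambda>\<omega>. (past i \<omega>, fst \<omega>)) (code_law i)) tw = pmf (bind_pmf (map_pmf (past i) (code_law i))
    (\<lambda>t. map_pmf (Pair t) (pair_pmf (pmf_of_set (compat1 t)) (pmf_of_set (compat2 t))))) tw"
    by (simp add: tw pmf_bind_map_Pair pmf_pair)
qed

section \<open>The law of a single channel use\<close>

definition step_law :: "nat \<Rightarrow> ((nat list \<times> nat list) \<times> nat \<times> nat) pmf" where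
  "step_law i = map_pmf (\<lambda>\<omega>. (past i \<omega>, input1 i \<omega>, input2 i \<omega>)) (code_law n)"

lemma take_simps:
  "i \<le> k \<Longrightarrow> input1 i (w, take k ys) = input1 i (w, ys)"
  "i \<le> k \<Longrightarrow> input2 i (w, take k ys) = input2 i (w, ys)"
  "i \<le> k \<Longrightarrow> past i (w, take k ys) = past i (w, ys)"
  "i < k \<Longrightarrow> received i (w, take k ys) = received i (w, ys)"
  by (auto simp: input1_def input2_def past_def received_def min_def)

lemma step_law_eq: "i \<le> n \<Longrightarrow> step_law i = map_pmf (\<lambda>\<omega>. (past i \<omega>, input1 i \<omega>, input2 i \<omega>)) (code_law i)"
  unfolding step_law_def map_take_code_law[of i n, symmetric] by (simp add: map_pmf_comp take_simps)

text \<open>Memorylessness: given all that precedes, the next output is drawn from the channel at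
  the current inputs. Each use thus becomes an instance of the single-time results.\<close>

lemma chan_law_step_law:
  assumes i: "i < n"
  shows "chan_law (step_law i) = map_pmf (\<lambda>\<omega>. (past i \<omega>, input1 i \<omega>, input2 i \<omega>, received i \<omega>)) (code_law n)"
proof -
  have "map_pmf (\<lambda>\<omega>. (past i \<omega>, input1 i \<omega>, input2 i \<omega>, received i \<omega>)) (code_law n)
      = map_pmf (\<lambda>\<omega>. (past i \<omega>, input1 i \<omega>, input2 i \<omega>, received i \<omega>)) (code_law (Suc i))"
    using i map_take_code_law[of "Suc i" n] by (simp add: map_pmf_comp take_simps flip: map_take_code_law[of "Suc i" n])
  also have "\<dots> = bind_pmf (code_law i) (\<lambda>\<omega>. map_pmf (\<lambda>y. (past i \<omega>, input1 i \<omega>, input2 i \<omega>, y))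
      (ban_channel (input1 i \<omega>) (input2 i \<omega>)))"
    unfolding code_law_Suc map_bind_pmf
  proof (intro bind_pmf_cong refl)
    fix \<omega> assume "\<omega> \<in> set_pmf (code_law i)"
    then have len: "length (snd \<omega>) = i" by (rule code_law_support)
    obtain w ys where \<omega>: "\<omega> = (w, ys)" by (cases \<omega>)
    have "past i (w, ys @ [y]) = past i (w, ys)" "input1 i (w, ys @ [y]) = input1 i (w, ys)"
      "input2 i (w, ys @ [y]) = input2 i (w, ys)" "received i (w, ys @ [y]) = y" for y
      using len by (auto simp: \<omega> past_def input1_def input2_def received_def)
    then show "map_pmf (\<lambda>\<omega>. (past i \<omega>, input1 i \<omega>, input2 i \<omega>, received i \<omega>)) (case \<omega> of (w, ys) \<Rightarrow>
          map_pmf (\<lambda>y. (w, ys @ [y])) (ban_channel (e1 (Suc i) (fst w) ys) (e2 (Suc i) (snd w) ys)))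
        = map_pmf (\<lambda>y. (past i \<omega>, input1 i \<omega>, input2 i \<omega>, y)) (ban_channel (input1 i \<omega>) (input2 i \<omega>))"
      using len by (simp add: \<omega> map_pmf_comp) (simp add: input1_def input2_def)
  qed
  also have "\<dots> = chan_law (step_law i)"
    using i by (simp add: step_law_eq chan_law_def bind_map_pmf)
  finally show ?thesis ..
qed

text \<open>Given the past, each current input is a function of its own message, so independence
  passes from the messages to the inputs.\<close>

lemma step_law_kernel_law:
  assumes i: "i < n"
  obtains pT :: "(nat list \<times> nat list) pmf" and p1 p2 where "finite (set_pmf pT)"
    "\<And>t. t \<in> set_pmf pT \<Longrightarrow> set_pmf (p1 t) \<subseteq> bits \<and> set_pmf (p2 t) \<subseteq> bits"
    "step_law i = kernel_law pT p1 p2"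
proof -
  let ?pT = "map_pmf (past i) (code_law i)"
  define p1 where "p1 = (\<lambda>t. map_pmf (\<lambda>w. e1 (Suc i) w (snd t)) (pmf_of_set (compat1 t)))"
  define p2 where "p2 = (\<lambda>t. map_pmf (\<lambda>w. e2 (Suc i) w (snd t)) (pmf_of_set (compat2 t)))"
  have fin: "finite (set_pmf ?pT)" using finite_code_law[of i] i by simp
  have "step_law i = map_pmf (\<lambda>(t, w1, w2). (t, e1 (Suc i) w1 (snd t), e2 (Suc i) w2 (snd t)))
      (map_pmf (\<lambda>\<omega>. (past i \<omega>, fst \<omega>)) (code_law i))"
    using i by (simp add: step_law_eq map_pmf_comp case_prod_unfold input1_def input2_def past_def)
  also have "\<dots> = kernel_law ?pT p1 p2"
    using i by (simp add: past_law_kernel kernel_law_def map_bind_pmf map_pmf_comp bind_map_pmf p1_def p2_def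
        map_pair[symmetric] case_prod_unfold map_prod_def)
  finally have eq: "step_law i = kernel_law ?pT p1 p2" .
  have "set_pmf (p1 t) \<subseteq> bits \<and> set_pmf (p2 t) \<subseteq> bits" if t: "t \<in> set_pmf ?pT" for t
  proof -
    have "pmf ?pT t \<noteq> 0" using t unfolding set_pmf_iff .
    then have ne: "compat1 t \<noteq> {}" "compat2 t \<noteq> {}" "length (snd t) = i"
      using i by (auto simp: pmf_past_marginal split: if_splits)
    have out: "set (snd t) \<subseteq> ban_outputs"
      using t code_law_outputs[of i] i by (fastforce simp: past_def dest: in_set_takeD)
    have "e1 (Suc i) w1 (snd t) \<in> bits" "e2 (Suc i) w2 (snd t) \<in> bits"
      if "w1 \<in> compat1 t" "w2 \<in> compat2 t" for w1 w2
    proof -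
      have "(w1, w2) \<in> msgs" using that compat_subset[of t] by blast
      from encoder_bits[OF this i ne(3) out]
      show "e1 (Suc i) w1 (snd t) \<in> bits" "e2 (Suc i) w2 (snd t) \<in> bits" .
    qed
    then show ?thesis
      using ne finite_compat[of t] by (auto simp: p1_def p2_def)
  qed
  then show ?thesis using fin eq by (intro that[of ?pT p1 p2]) auto
qed

lemma binary_law_step_law: "i < n \<Longrightarrow> binary_law (step_law i)"
  by (metis step_law_kernel_law binary_law_kernel_law)

lemma profile_step_law: "i < n \<Longrightarrow> profile (step_law i) \<in> profiles"
  by (metis step_law_kernel_law profile_kernel_law_in_profiles)

section \<open>Entropy bounds along the block\<close>

lemma finite_code_law_n: "finite (set_pmf (code_law n))"
  by (rule finite_code_law) simp

lemma ent_all: "ent (code_law n) (\<lambda>\<omega>. \<omega>) = log 2 M1 + log 2 M2 + n"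
proof -
  have "ent (code_law n) (\<lambda>\<omega>. \<omega>) = measure_pmf.expectation (code_law n) (\<lambda>\<omega>. log 2 M1 + log 2 M2 + n)"
    unfolding ent_def
  proof (rule integral_cong_AE)
    show "AE \<omega> in measure_pmf (code_law n). - log 2 (pmf (map_pmf (\<lambda>\<omega>. \<omega>) (code_law n)) \<omega>) = log 2 M1 + log 2 M2 + n"
    proof (subst AE_measure_pmf_iff, intro ballI)
      fix \<omega> assume w: "\<omega> \<in> set_pmf (code_law n)"
      obtain w1 w2 ys where \<omega>: "\<omega> = ((w1, w2), ys)" by (metis prod.exhaust)
      have "pmf (code_law n) \<omega> = (1 / 2) ^ n / (real M1 * real M2)"
        using code_law_support[OF w] by (simp add: \<omega> pmf_code_law)
      then show "- log 2 (pmf (map_pmf (\<lambda>\<omega>. \<omega>) (code_law n)) \<omega>) = log 2 M1 + log 2 M2 + n"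
        using M1 M2 by (simp add: log_divide log_mult log_nat_power power_one_over)
    qed
  qed auto
  then show ?thesis by simp
qed

text \<open>This and the next lemmas express which variables determine which, in the form that
  \<open>ent_cong\<close> consumes.\<close>

lemma input1_cong: "fst (fst \<omega>) = fst (fst \<omega>') \<Longrightarrow> take j (snd \<omega>) = take j (snd \<omega>') \<Longrightarrow> input1 j \<omega> = input1 j \<omega>'"
  by (simp add: input1_def)

lemma input2_cong: "snd (fst \<omega>) = snd (fst \<omega>') \<Longrightarrow> take j (snd \<omega>) = take j (snd \<omega>') \<Longrightarrow> input2 j \<omega> = input2 j \<omega>'"
  by (simp add: input2_def)

lemma past_cong:
  assumes "fst (fst \<omega>) = fst (fst \<omega>')" "take i (snd \<omega>) = take i (snd \<omega>')"
  shows "past i \<omega> = past i \<omega>'"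
proof -
  have "take j (snd \<omega>) = take j (snd \<omega>')" if "j < i" for j
    using arg_cong[OF assms(2), of "take j"] that by (simp add: min_def)
  then show ?thesis using assms by (auto simp: past_def intro: input1_cong)
qed

lemma take_Suc_eq_iff:
  assumes "i < n" "\<omega> \<in> set_pmf (code_law n)" "\<omega>' \<in> set_pmf (code_law n)"
  shows "take (Suc i) (snd \<omega>) = take (Suc i) (snd \<omega>')
    \<longleftrightarrow> take i (snd \<omega>) = take i (snd \<omega>') \<and> received i \<omega> = received i \<omega>'"
  using code_law_support(2)[OF assms(2)] code_law_support(2)[OF assms(3)] assms(1)
  by (simp add: take_Suc_conv_app_nth received_def)

lemma past_eqD: "past i \<omega> = past i \<omega>' \<Longrightarrow> take i (snd \<omega>) = take i (snd \<omega>')"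
  by (simp add: past_def)

lemma past_Suc_eq_iff:
  assumes "i < n" "\<omega> \<in> set_pmf (code_law n)" "\<omega>' \<in> set_pmf (code_law n)"
  shows "past (Suc i) \<omega> = past (Suc i) \<omega>'
    \<longleftrightarrow> past i \<omega> = past i \<omega>' \<and> input1 i \<omega> = input1 i \<omega>' \<and> received i \<omega> = received i \<omega>'"
  using take_Suc_eq_iff[OF assms] by (auto simp: past_def)

lemma ent_code_law_step_law: "ent (code_law n) (\<lambda>\<omega>. f (past i \<omega>) (input1 i \<omega>) (input2 i \<omega>)) = ent (step_law i) (\<lambda>(t, x1, x2). f t x1 x2)"
  by (simp add: step_law_def ent_map_pmf)

lemma ent_code_law_chan: "i < n \<Longrightarrow> ent (code_law n) (\<lambda>\<omega>. f (past i \<omega>) (input1 i \<omega>) (input2 i \<omega>) (received i \<omega>))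
    = ent (chan_law (step_law i)) (\<lambda>(t, x1, x2, y). f t x1 x2 y)"
  by (simp add: chan_law_step_law ent_map_pmf)

text \<open>The first message and the past outputs determine the past and the current input of user
  1. These are adjoined, and submodularity then keeps only them in the conditioning of the new
  output.\<close>

lemma ent_outputs_given_message1:
  "i \<le> n \<Longrightarrow> ent (code_law n) (\<lambda>\<omega>. (fst (fst \<omega>), take i (snd \<omega>)))
     \<le> log 2 M1 + (\<Sum>j<i. 1 + cond_ent2 (step_law j) / 2)"
proof (induction i)
  case 0
  have "ent (code_law n) (\<lambda>\<omega>. (fst (fst \<omega>), take 0 (snd \<omega>))) = ent (code_law n) (\<lambda>\<omega>. fst (fst \<omega>))"
    by (rule ent_cong) simp
  also have "\<dots> \<le> log 2 (card {1..M1})"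
    using code_law_support(1) by (intro ent_le_log_card finite_code_law_n) (auto simp: mem_Times_iff)
  finally show ?case by simp
next
  case (Suc i)
  then have i: "i < n" by simp
  let ?H = "ent (code_law n)"
  have "?H (\<lambda>\<omega>. (fst (fst \<omega>), take (Suc i) (snd \<omega>)))
      = ?H (\<lambda>\<omega>. (received i \<omega>, (fst (fst \<omega>), take i (snd \<omega>)), (past i \<omega>, input1 i \<omega>)))"
    by (rule ent_cong) (auto simp: take_Suc_eq_iff[OF i] intro: input1_cong past_cong)
  also have "\<dots> \<le> ?H (\<lambda>\<omega>. (received i \<omega>, (past i \<omega>, input1 i \<omega>)))
      + ?H (\<lambda>\<omega>. ((fst (fst \<omega>), take i (snd \<omega>)), (past i \<omega>, input1 i \<omega>))) - ?H (\<lambda>\<omega>. (past i \<omega>, input1 i \<omega>))"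
    using ent_submodular[OF finite_code_law_n, of "received i" "\<lambda>\<omega>. (fst (fst \<omega>), take i (snd \<omega>))"
        "\<lambda>\<omega>. (past i \<omega>, input1 i \<omega>)"] by simp
  also have "?H (\<lambda>\<omega>. ((fst (fst \<omega>), take i (snd \<omega>)), (past i \<omega>, input1 i \<omega>)))
      = ?H (\<lambda>\<omega>. (fst (fst \<omega>), take i (snd \<omega>)))"
    by (rule ent_cong) (auto intro: input1_cong past_cong)
  also have "?H (\<lambda>\<omega>. (received i \<omega>, (past i \<omega>, input1 i \<omega>))) = ?H (\<lambda>\<omega>. (past i \<omega>, input1 i \<omega>, received i \<omega>))"
    by (rule ent_cong) auto
  finally show ?case
    using Suc.IH i ent_output_given_input1_aux_le[OF binary_law_step_law[OF i]]
      ent_code_law_chan[OF i, of "\<lambda>t x1 x2 y. (t, x1, y)"] ent_code_law_step_law[of "\<lambda>t x1 x2. (t, x1)" i]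
    by simp
qed

lemma ent_outputs:
  "i \<le> n \<Longrightarrow> ent (code_law n) (\<lambda>\<omega>. take i (snd \<omega>))
     \<le> (\<Sum>j<i. 1 + info_both (mean1 (step_law j)) (mean2 (step_law j)) (mean12 (step_law j)))"
proof (induction i)
  case 0
  show ?case by (simp add: ent_const)
next
  case (Suc i)
  then have i: "i < n" by simp
  let ?H = "ent (code_law n)"
  \<comment> \<open>Conditioning on the unit value turns submodularity into plain
    subadditivity.\<close>
  have "?H (\<lambda>\<omega>. take (Suc i) (snd \<omega>)) = ?H (\<lambda>\<omega>. (received i \<omega>, take i (snd \<omega>), ()))"
    by (rule ent_cong) (auto simp: take_Suc_eq_iff[OF i])
  also have "\<dots> \<le> ?H (\<lambda>\<omega>. (received i \<omega>, ())) + ?H (\<lambda>\<omega>. (take i (snd \<omega>), ()))"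
    using ent_submodular[OF finite_code_law_n, of "received i" "\<lambda>\<omega>. take i (snd \<omega>)" "\<lambda>\<omega>. ()"] by (simp add: ent_const)
  also have "?H (\<lambda>\<omega>. (received i \<omega>, ())) = ?H (received i)" by (rule ent_cong) simp
  also have "?H (\<lambda>\<omega>. (take i (snd \<omega>), ())) = ?H (\<lambda>\<omega>. take i (snd \<omega>))" by (rule ent_cong) simp
  finally show ?case
    using Suc.IH i ent_output[OF binary_law_step_law[OF i]] ent_code_law_chan[OF i, of "\<lambda>t x1 x2 y. y"] by simp
qed

lemma ent_outputs_given_message2:
  "i \<le> n \<Longrightarrow> ent (code_law n) (\<lambda>\<omega>. (snd (fst \<omega>), take i (snd \<omega>)))
     \<le> log 2 M2 + (\<Sum>j<i. 1 + info_one (mean1 (step_law j)) (mean2 (step_law j)) (mean12 (step_law j)))"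
proof (induction i)
  case 0
  have "ent (code_law n) (\<lambda>\<omega>. (snd (fst \<omega>), take 0 (snd \<omega>))) = ent (code_law n) (\<lambda>\<omega>. snd (fst \<omega>))"
    by (rule ent_cong) simp
  also have "\<dots> \<le> log 2 (card {1..M2})"
    using code_law_support(1) by (intro ent_le_log_card finite_code_law_n) (auto simp: mem_Times_iff)
  finally show ?case by simp
next
  case (Suc i)
  then have i: "i < n" by simp
  let ?H = "ent (code_law n)"
  have "?H (\<lambda>\<omega>. (snd (fst \<omega>), take (Suc i) (snd \<omega>)))
      = ?H (\<lambda>\<omega>. (received i \<omega>, (snd (fst \<omega>), take i (snd \<omega>)), input2 i \<omega>))"
    by (rule ent_cong) (auto simp: take_Suc_eq_iff[OF i] intro: input2_cong)
  also have "\<dots> \<le> ?H (\<lambda>\<omega>. (received i \<omega>, input2 i \<omega>))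
      + ?H (\<lambda>\<omega>. ((snd (fst \<omega>), take i (snd \<omega>)), input2 i \<omega>)) - ?H (input2 i)"
    using ent_submodular[OF finite_code_law_n, of "received i" "\<lambda>\<omega>. (snd (fst \<omega>), take i (snd \<omega>))" "input2 i"] by simp
  also have "?H (\<lambda>\<omega>. ((snd (fst \<omega>), take i (snd \<omega>)), input2 i \<omega>)) = ?H (\<lambda>\<omega>. (snd (fst \<omega>), take i (snd \<omega>)))"
    by (rule ent_cong) (auto intro: input2_cong)
  also have "?H (\<lambda>\<omega>. (received i \<omega>, input2 i \<omega>)) = ?H (\<lambda>\<omega>. (input2 i \<omega>, received i \<omega>))"
    by (rule ent_cong) auto
  finally show ?case
    using Suc.IH i ent_output_given_input2[OF binary_law_step_law[OF i]]
      ent_code_law_chan[OF i, of "\<lambda>t x1 x2 y. (x2, y)"] ent_code_law_step_law[of "\<lambda>t x1 x2. x2" i]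
    by simp
qed

text \<open>\<open>W2\<close> and the past determine the current input of user 2. One step adds
  \<open>X1\<close>, whose entropy given \<open>W2\<close> and the past is at most
  \<open>H(X1 | T)\<close>, and the output, which given both inputs carries exactly the noise
  bit.\<close>

lemma ent_past_given_message2:
  "i \<le> n \<Longrightarrow> ent (code_law n) (\<lambda>\<omega>. (snd (fst \<omega>), past i \<omega>)) \<le> log 2 M2 + (\<Sum>j<i. 1 + cond_ent1 (step_law j))"
proof (induction i)
  case 0
  have "ent (code_law n) (\<lambda>\<omega>. (snd (fst \<omega>), past 0 \<omega>)) = ent (code_law n) (\<lambda>\<omega>. snd (fst \<omega>))"
    by (rule ent_cong) (simp add: past_def)
  also have "\<dots> \<le> log 2 (card {1..M2})"
    using code_law_support(1) by (intro ent_le_log_card finite_code_law_n) (auto simp: mem_Times_iff)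
  finally show ?case by simp
next
  case (Suc i)
  then have i: "i < n" by simp
  let ?H = "ent (code_law n)"
  have "?H (\<lambda>\<omega>. (snd (fst \<omega>), past (Suc i) \<omega>))
      = ?H (\<lambda>\<omega>. (received i \<omega>, (snd (fst \<omega>), past i \<omega>), (input1 i \<omega>, input2 i \<omega>)))"
    by (rule ent_cong) (auto simp: past_Suc_eq_iff[OF i] intro: input2_cong past_eqD)
  also have "\<dots> \<le> ?H (\<lambda>\<omega>. (received i \<omega>, (input1 i \<omega>, input2 i \<omega>)))
      + ?H (\<lambda>\<omega>. ((snd (fst \<omega>), past i \<omega>), (input1 i \<omega>, input2 i \<omega>))) - ?H (\<lambda>\<omega>. (input1 i \<omega>, input2 i \<omega>))"
    using ent_submodular[OF finite_code_law_n, of "received i" "\<lambda>\<omega>. (snd (fst \<omega>), past i \<omega>)" "\<lambda>\<omega>. (input1 i \<omega>, input2 i \<omega>)"]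
    by simp
  also have "?H (\<lambda>\<omega>. (received i \<omega>, (input1 i \<omega>, input2 i \<omega>))) = ?H (\<lambda>\<omega>. (input1 i \<omega>, input2 i \<omega>, received i \<omega>))"
    by (rule ent_cong) auto
  also have "?H (\<lambda>\<omega>. ((snd (fst \<omega>), past i \<omega>), (input1 i \<omega>, input2 i \<omega>)))
      = ?H (\<lambda>\<omega>. (input1 i \<omega>, snd (fst \<omega>), past i \<omega>))"
    by (rule ent_cong) (auto intro: input2_cong past_eqD)
  also have "\<dots> \<le> ?H (\<lambda>\<omega>. (input1 i \<omega>, past i \<omega>)) + ?H (\<lambda>\<omega>. (snd (fst \<omega>), past i \<omega>)) - ?H (past i)"
    using ent_submodular[OF finite_code_law_n, of "input1 i" "\<lambda>\<omega>. snd (fst \<omega>)" "past i"] by simp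
  also have "?H (\<lambda>\<omega>. (input1 i \<omega>, past i \<omega>)) = ?H (\<lambda>\<omega>. (past i \<omega>, input1 i \<omega>))"
    by (rule ent_cong) auto
  finally have "?H (\<lambda>\<omega>. (snd (fst \<omega>), past (Suc i) \<omega>)) \<le> ?H (\<lambda>\<omega>. (snd (fst \<omega>), past i \<omega>))
      + (?H (\<lambda>\<omega>. (input1 i \<omega>, input2 i \<omega>, received i \<omega>)) - ?H (\<lambda>\<omega>. (input1 i \<omega>, input2 i \<omega>)))
      + (?H (\<lambda>\<omega>. (past i \<omega>, input1 i \<omega>)) - ?H (past i))" by simp
  moreover have "?H (\<lambda>\<omega>. (input1 i \<omega>, input2 i \<omega>, received i \<omega>)) - ?H (\<lambda>\<omega>. (input1 i \<omega>, input2 i \<omega>)) = 1"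
  proof -
    have "ent (step_law i) (\<lambda>(t, x1, x2). (x1, x2)) = ent (step_law i) snd" by (rule ent_cong) auto
    then show ?thesis
      using ent_chan_law_inputs_output[OF binary_law_step_law[OF i]]
        ent_code_law_chan[OF i, of "\<lambda>t x1 x2 y. (x1, x2, y)"] ent_code_law_step_law[of "\<lambda>t x1 x2. (x1, x2)" i] by simp
  qed
  moreover have "?H (\<lambda>\<omega>. (past i \<omega>, input1 i \<omega>)) - ?H (past i) = cond_ent1 (step_law i)"
  proof -
    have "ent (step_law i) (\<lambda>(t, x1, x2). t) = ent (step_law i) fst" by (rule ent_cong) auto
    then show ?thesis
      using ent_code_law_step_law[of "\<lambda>t x1 x2. (t, x1)" i] ent_code_law_step_law[of "\<lambda>t x1 x2. t" i] by (simp add: cond_ent1_def)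
  qed
  ultimately show ?case using Suc.IH i by simp
qed

section \<open>Fano's inequality and the rate bounds\<close>

definition slack :: "(nat list \<Rightarrow> nat \<times> nat) \<Rightarrow> real" where
  "slack g = 2 + error_prob ban_channel n M1 M2 e1 e2 g * (log 2 M1 + log 2 M2)"

text \<open>Adjoining any \<open>V\<close> to the outputs cannot increase the remaining uncertainty
  about the messages, which Fano's inequality bounds by \<open>slack g\<close>.\<close>

lemma ent_all_le:
  "ent (code_law n) (\<lambda>\<omega>. \<omega>) \<le> slack g + ent (code_law n) (\<lambda>\<omega>. (V \<omega>, snd \<omega>))"
proof -
  let ?H = "ent (code_law n)"
  have "?H (\<lambda>\<omega>. \<omega>) \<le> ?H (\<lambda>\<omega>. (fst \<omega>, V \<omega>, snd \<omega>))"
    by (rule ent_mono[OF finite_code_law_n]) (auto simp: prod_eq_iff)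
  also have "\<dots> \<le> ?H (\<lambda>\<omega>. (fst \<omega>, snd \<omega>)) - ?H snd + ?H (\<lambda>\<omega>. (V \<omega>, snd \<omega>))"
    using ent_submodular[OF finite_code_law_n, of fst V snd] by simp
  also have "?H (\<lambda>\<omega>. (fst \<omega>, snd \<omega>)) - ?H snd
      \<le> 2 + measure_pmf.prob (code_law n) {\<omega>. g (snd \<omega>) \<noteq> fst \<omega>} * log 2 (card msgs)"
    using code_law_support(1) by (intro ent_fano finite_code_law_n) auto
  also have "\<dots> = slack g"
    using M1 M2 by (simp add: slack_def error_prob_def code_law_def log_mult case_prod_unfold card_cartesian_product)
  finally show ?thesis by simp
qed

text \<open>\<open>V\<close> is in turn \<open>W1\<close>, nothing, \<open>W2\<close>, and
  \<open>W2\<close> with the past of user 1. On subtracting the chain rules from the exact total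
  entropy, the \<open>n\<close> noise bits cancel, and so does the message contained in
  \<open>V\<close>.\<close>

lemma message_bounds:
  shows "log 2 M2 \<le> slack g + (\<Sum>j<n. cond_ent2 (step_law j) / 2)"
    and "log 2 M1 + log 2 M2 \<le> slack g + (\<Sum>j<n. info_both (mean1 (step_law j)) (mean2 (step_law j)) (mean12 (step_law j)))"
    and "log 2 M1 \<le> slack g + (\<Sum>j<n. info_one (mean1 (step_law j)) (mean2 (step_law j)) (mean12 (step_law j)))"
    and "log 2 M1 \<le> slack g + (\<Sum>j<n. cond_ent1 (step_law j))"
proof -
  let ?H = "ent (code_law n)"
  have all: "?H (\<lambda>\<omega>. (V \<omega>, take n (snd \<omega>))) = ?H (\<lambda>\<omega>. (V \<omega>, snd \<omega>))" for V :: "_ \<Rightarrow> 'c"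
    by (rule ent_cong) (simp add: code_law_support(2))
  show "log 2 M2 \<le> slack g + (\<Sum>j<n. cond_ent2 (step_law j) / 2)"
    using ent_all_le[of g "\<lambda>\<omega>. fst (fst \<omega>)"] ent_outputs_given_message1[of n]
    by (simp add: ent_all all sum.distrib)
  show "log 2 M1 \<le> slack g + (\<Sum>j<n. info_one (mean1 (step_law j)) (mean2 (step_law j)) (mean12 (step_law j)))"
    using ent_all_le[of g "\<lambda>\<omega>. snd (fst \<omega>)"] ent_outputs_given_message2[of n]
    by (simp add: ent_all all sum.distrib)
  have "?H (\<lambda>\<omega>. ((), snd \<omega>)) = ?H (\<lambda>\<omega>. take n (snd \<omega>))"
    by (rule ent_cong) (simp add: code_law_support(2))
  then show "log 2 M1 + log 2 M2 \<le> slack g + (\<Sum>j<n. info_both (mean1 (step_law j)) (mean2 (step_law j)) (mean12 (step_law j)))"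
    using ent_all_le[of g "\<lambda>\<omega>. ()"] ent_outputs[of n] by (simp add: ent_all sum.distrib)
  have "?H (\<lambda>\<omega>. ((snd (fst \<omega>), past n \<omega>), snd \<omega>)) = ?H (\<lambda>\<omega>. (snd (fst \<omega>), past n \<omega>))"
    by (rule ent_cong) (auto simp: past_def code_law_support(2))
  then show "log 2 M1 \<le> slack g + (\<Sum>j<n. cond_ent1 (step_law j))"
    using ent_all_le[of g "\<lambda>\<omega>. (snd (fst \<omega>), past n \<omega>)"] ent_past_given_message2[of n]
    by (simp add: ent_all sum.distrib)
qed

text \<open>Four output letters carry at most two bits, one of which is noise.\<close>

lemma info_both_step_law_le_1: "i < n \<Longrightarrow> info_both (mean1 (step_law i)) (mean2 (step_law i)) (mean12 (step_law i)) \<le> 1"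
proof -
  assume i: "i < n"
  have "ent (chan_law (step_law i)) (\<lambda>(t, x1, x2, y). y) \<le> log 2 (card ban_outputs)"
  proof (rule ent_le_log_card)
    show "finite (set_pmf (chan_law (step_law i)))"
      using binary_law_step_law[OF i] by (intro finite_set_pmf_chan_law) (simp add: binary_law_def)
    show "(\<lambda>(t, x1, x2, y). y) ` set_pmf (chan_law (step_law i)) \<subseteq> ban_outputs"
      using binary_law_step_law[OF i]
      by (auto simp: chan_law_def binary_law_def set_pmf_ban_channel_eq bits_def ban_outputs_def)
  qed (simp add: ban_outputs_def)
  also have "\<dots> = 2" using log_nat_power[of 2 2 2] by (simp add: ban_outputs_def)
  finally show ?thesis by (simp add: ent_output[OF binary_law_step_law[OF i]])
qed

text \<open>Achievability bounds the message sets only from below, so the logarithm in Fano's term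
  needs its own bound. The sum-rate bound gives \<open>?l \<le> 2 + ?e * ?l + n\<close>, and
  \<open>?e \<le> 1 / 2\<close> absorbs the middle term.\<close>

lemma slack_le:
  assumes err: "error_prob ban_channel n M1 M2 e1 e2 g \<le> \<epsilon>" and \<epsilon>: "\<epsilon> \<le> 1 / 2"
  shows "slack g \<le> 2 + \<epsilon> * (2 * real n + 4)"
proof -
  let ?l = "log 2 M1 + log 2 M2" and ?e = "error_prob ban_channel n M1 M2 e1 e2 g"
  have l: "0 \<le> ?l" using M1 M2 by simp
  have e: "0 \<le> ?e" by (simp add: error_prob_def)
  have "(\<Sum>j<n. info_both (mean1 (step_law j)) (mean2 (step_law j)) (mean12 (step_law j))) \<le> (\<Sum>j<n. 1)"
    by (intro sum_mono info_both_step_law_le_1) simp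
  then have "?l \<le> 2 + ?e * ?l + n" using message_bounds(2)[of g] by (simp add: slack_def)
  moreover have "?e * ?l \<le> 1 / 2 * ?l" using err \<epsilon> l by (intro mult_right_mono) auto
  ultimately have "?l \<le> 2 * real n + 4" by simp
  then have "?e * ?l \<le> \<epsilon> * (2 * real n + 4)" using err e l by (intro mult_mono) auto
  then show ?thesis by (simp add: slack_def)
qed

lemma slack_nonneg: "0 \<le> slack g"
  using M1 M2 by (simp add: slack_def error_prob_def)

lemma rates_in_outer_region:
  assumes n: "0 < n"
  shows "((log 2 M1 - slack g) / n, (log 2 M2 - slack g) / n) \<in> outer_region"
proof -
  define v where "v = (\<Sum>i<n. (1 / real n) *\<^sub>R profile (step_law i))"
  have w: "(\<Sum>i<n. 1 / real n) = 1" using n by simp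
  have ne: "{..<n} \<noteq> {}" using n by auto
  have v: "v \<in> profiles"
    unfolding v_def profiles_def
    by (rule convex_sum[OF finite_lessThan convex_convex_hull w])
      (use profile_step_law in \<open>simp_all add: profiles_def\<close>)
  have marg: "profile (step_law i) \<in> marginals" if "i < n" for i
    using profile_step_law[OF that] profiles_subset_marginals by blast
  have v_eq: "v = ((\<Sum>i<n. mean1 (step_law i)) / n, (\<Sum>i<n. mean2 (step_law i)) / n, (\<Sum>i<n. mean12 (step_law i)) / n,
      (\<Sum>i<n. cond_ent1 (step_law i)) / n, (\<Sum>i<n. cond_ent2 (step_law i)) / n)"
    by (simp add: v_def profile_def prod_eq_iff fst_sum snd_sum sum_divide_distrib)
  obtain a b c u u' where abc: "v = (a, b, c, u, u')" by (metis prod_cases5)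
  have "(\<Sum>i<n. (1 / real n) * (case profile (step_law i) of (a, b, c, u, w) \<Rightarrow> info_one a b c))
      \<le> (case v of (a, b, c, u, w) \<Rightarrow> info_one a b c)"
    unfolding v_def by (rule concave_on_sum[OF finite_lessThan ne concave_info_one w]) (use marg in auto)
  then have hI: "(\<Sum>i<n. info_one (mean1 (step_law i)) (mean2 (step_law i)) (mean12 (step_law i))) / n \<le> info_one a b c"
    by (simp add: abc profile_def sum_divide_distrib)
  have "(\<Sum>i<n. (1 / real n) * (case profile (step_law i) of (a, b, c, u, w) \<Rightarrow> info_both a b c))
      \<le> (case v of (a, b, c, u, w) \<Rightarrow> info_both a b c)"
    unfolding v_def by (rule concave_on_sum[OF finite_lessThan ne concave_info_both w]) (use marg in auto)
  then have hS: "(\<Sum>i<n. info_both (mean1 (step_law i)) (mean2 (step_law i)) (mean12 (step_law i))) / n \<le> info_both a b c"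
    by (simp add: abc profile_def sum_divide_distrib)
  have uu: "u = (\<Sum>i<n. cond_ent1 (step_law i)) / n" "u' = (\<Sum>i<n. cond_ent2 (step_law i)) / n"
    using v_eq abc by auto
  have "(log 2 M1 - slack g) / n \<le> (\<Sum>i<n. info_one (mean1 (step_law i)) (mean2 (step_law i)) (mean12 (step_law i))) / n"
    using message_bounds(3)[of g] by (intro divide_right_mono) auto
  then have 1: "(log 2 M1 - slack g) / n \<le> info_one a b c" using hI by linarith
  have 2: "(log 2 M1 - slack g) / n \<le> u"
    unfolding uu using message_bounds(4)[of g] by (intro divide_right_mono) auto
  have "(log 2 M2 - slack g) / n \<le> (\<Sum>i<n. cond_ent2 (step_law i) / 2) / n"
    using message_bounds(1)[of g] by (intro divide_right_mono) auto
  then have 3: "(log 2 M2 - slack g) / n \<le> u' / 2"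
    unfolding uu by (simp add: sum_divide_distrib[symmetric])
  \<comment> \<open>The sum bound costs one slack; the second is nonnegative and may be subtracted
    too.\<close>
  have "(log 2 M1 - slack g) / n + (log 2 M2 - slack g) / n
      = (log 2 M1 + log 2 M2 - 2 * slack g) / n"
    by (simp add: add_divide_distrib[symmetric])
  also have "\<dots> \<le> (\<Sum>i<n. info_both (mean1 (step_law i)) (mean2 (step_law i)) (mean12 (step_law i))) / n"
    using message_bounds(2)[of g] slack_nonneg[of g] by (intro divide_right_mono) auto
  finally have 4: "(log 2 M1 - slack g) / n + (log 2 M2 - slack g) / n \<le> info_both a b c" using hS by linarith
  have "admits v ((log 2 M1 - slack g) / n, (log 2 M2 - slack g) / n)"
    using 1 2 3 4 by (simp add: abc admits_def)
  then show ?thesis unfolding outer_region_def using v by blast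
qed

end

section \<open>Passage to the limit\<close>

lemma outer_region_mono:
  "(R1, R2) \<in> outer_region \<Longrightarrow> S1 \<le> R1 \<Longrightarrow> S2 \<le> R2 \<Longrightarrow> (S1, S2) \<in> outer_region"
  unfolding outer_region_def admits_def by fastforce

lemma achievable_outer_region_approx:
  assumes R: "achievable bits bits ban_outputs ban_channel R1 R2" and \<delta>: "0 < \<delta>"
  shows "(R1 - \<delta>, R2 - \<delta>) \<in> outer_region"
proof -
  \<comment> \<open>\<open>1 / 2\<close> is the threshold of \<open>slack_le\<close>. Since
    \<open>2 * n + 4 \<le> 6 * n\<close>, the error term is at most \<open>\<delta> * n / 2\<close>;
    the constant 2 is at most the other half once \<open>n \<ge> 4 / \<delta>\<close>.\<close>
  define \<epsilon> where "\<epsilon> = min (1 / 2) (\<delta> / 12)"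
  have \<epsilon>: "0 < \<epsilon>" "\<epsilon> \<le> 1 / 2" "\<epsilon> \<le> \<delta> / 12" using \<delta> by (auto simp: \<epsilon>_def)
  from R \<epsilon>(1) have "\<forall>\<^sub>F n in sequentially. \<exists>M1 M2 e1 e2 g.
        is_code bits bits ban_outputs n M1 M2 e1 e2 g \<and>
        R1 \<le> log 2 (real M1) / real n \<and> R2 \<le> log 2 (real M2) / real n \<and>
        error_prob ban_channel n M1 M2 e1 e2 g \<le> \<epsilon>"
    by (simp add: achievable_def)
  moreover have "\<forall>\<^sub>F n in sequentially. 4 / \<delta> \<le> real n"
    using filterlim_real_sequentially by (auto simp: filterlim_at_top)
  ultimately have "\<forall>\<^sub>F n in sequentially. (R1 - \<delta>, R2 - \<delta>) \<in> outer_region"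
    using eventually_gt_at_top[of 0]
  proof eventually_elim
    case (elim n)
    then obtain M1 M2 e1 e2 g where code: "is_code bits bits ban_outputs n M1 M2 e1 e2 g"
      and rates: "R1 \<le> log 2 (real M1) / real n" "R2 \<le> log 2 (real M2) / real n"
      and err: "error_prob ban_channel n M1 M2 e1 e2 g \<le> \<epsilon>" by blast
    interpret feedback_code n M1 M2 e1 e2
      using code by unfold_locales (auto simp: is_code_def)
    have n: "1 \<le> real n" using elim(3) by simp
    have "slack g \<le> 2 + \<epsilon> * (2 * real n + 4)" by (rule slack_le[OF err \<epsilon>(2)])
    also have "\<dots> \<le> \<delta> * n / 2 + \<delta> / 12 * (6 * n)"
      using elim(2) \<epsilon> \<delta> n by (intro add_mono mult_mono) (auto simp: field_simps)
    finally have "slack g / n \<le> \<delta>" using n by (simp add: field_simps)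
    then have "R1 - \<delta> \<le> (log 2 M1 - slack g) / n" "R2 - \<delta> \<le> (log 2 M2 - slack g) / n"
      using rates by (simp_all add: diff_divide_distrib)
    then show ?case using rates_in_outer_region[OF elim(3), of g] outer_region_mono by blast
  qed
  then show ?thesis by simp
qed

lemma achievable_outer_region:
  assumes R: "achievable bits bits ban_outputs ban_channel R1 R2"
  shows "(R1, R2) \<in> outer_region"
proof -
  have "(\<lambda>k. (R1 - 1 / Suc k, R2 - 1 / Suc k)) \<longlonglongrightarrow> (R1 - 0, R2 - 0)"
    by (intro tendsto_intros LIMSEQ_Suc[OF lim_1_over_n])
  then show ?thesis
    using closed_sequentially[OF closed_outer_region, of "\<lambda>k. (R1 - 1 / Suc k, R2 - 1 / Suc k)"]
      achievable_outer_region_approx[OF R] by simp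
qed

section \<open>Symmetry of achievability and conclusion\<close>

lemma output_pmf_swap:
  "output_pmf ban_channel e2 e1 w2 w1 i = output_pmf ban_channel e1 e2 w1 w2 i"
  by (induction i) (simp_all add: ban_channel_commute[of "e2 _ _ _"])

lemma error_prob_swap:
  "error_prob ban_channel n M2 M1 e2 e1 (\<lambda>ys. prod.swap (g ys)) = error_prob ban_channel n M1 M2 e1 e2 g"
proof -
  have "message_output_pmf ban_channel n M2 M1 e2 e1
      = map_pmf (\<lambda>(w, ys). (prod.swap w, ys)) (message_output_pmf ban_channel n M1 M2 e1 e2)"
    unfolding message_output_pmf_def
    by (subst pair_commute_pmf)
      (simp add: bind_map_pmf map_bind_pmf map_pmf_comp case_prod_unfold prod.swap_def output_pmf_swap)
  then show ?thesis
    unfolding error_prob_def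
    by (simp add: vimage_def case_prod_unfold) (metis swap_swap)
qed

lemma achievable_swap:
  assumes "achievable bits bits ban_outputs ban_channel R1 R2"
  shows "achievable bits bits ban_outputs ban_channel R2 R1"
  unfolding achievable_def
proof (intro conjI allI impI)
  show "0 \<le> R2" "0 \<le> R1" using assms by (auto simp: achievable_def)
  fix \<epsilon> :: real assume "0 < \<epsilon>"
  with assms have "\<forall>\<^sub>F n in sequentially. \<exists>M1 M2 e1 e2 g.
        is_code bits bits ban_outputs n M1 M2 e1 e2 g \<and>
        R1 \<le> log 2 (real M1) / real n \<and> R2 \<le> log 2 (real M2) / real n \<and>
        error_prob ban_channel n M1 M2 e1 e2 g \<le> \<epsilon>"
    by (simp add: achievable_def)
  then show "\<forall>\<^sub>F n in sequentially. \<exists>M1 M2 e1 e2 g.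
        is_code bits bits ban_outputs n M1 M2 e1 e2 g \<and>
        R2 \<le> log 2 (real M1) / real n \<and> R1 \<le> log 2 (real M2) / real n \<and>
        error_prob ban_channel n M1 M2 e1 e2 g \<le> \<epsilon>"
  proof eventually_elim
    case (elim n)
    then obtain M1 M2 e1 e2 g where code: "is_code bits bits ban_outputs n M1 M2 e1 e2 g"
      and rates: "R1 \<le> log 2 (real M1) / real n" "R2 \<le> log 2 (real M2) / real n"
      and err: "error_prob ban_channel n M1 M2 e1 e2 g \<le> \<epsilon>" by blast
    have "is_code bits bits ban_outputs n M2 M1 e2 e1 (\<lambda>ys. prod.swap (g ys))"
      using code by (auto simp: is_code_def prod.swap_def mem_Times_iff)
    moreover have "error_prob ban_channel n M2 M1 e2 e1 (\<lambda>ys. prod.swap (g ys)) \<le> \<epsilon>"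
      using err by (simp only: error_prob_swap)
    ultimately show ?case using rates by blast
  qed
qed

theorem mainTheorem1:
  shows "capacity_region bits bits ban_outputs ban_channel \<subseteq> DB1 \<inter> DB2"
proof
  fix R assume R: "R \<in> capacity_region bits bits ban_outputs ban_channel"
  let ?A = "{(R1, R2). achievable bits bits ban_outputs ban_channel R1 R2}"
  \<comment> \<open>Membership in both orders, together with the nonnegativity that
    \<open>outer_region\<close> omits. The set is closed, so it contains the closure of the
    achievable pairs.\<close>
  let ?C = "{R. R \<in> outer_region \<and> (snd R, fst R) \<in> outer_region \<and> 0 \<le> fst R \<and> 0 \<le> snd R}"
  have "closed {R. (snd R, fst R) \<in> outer_region}"
    using closed_vimage[OF closed_outer_region, of "\<lambda>R. (snd R, fst R)"]
    by (simp add: vimage_def continuous_intros)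
  then have "closed ?C"
    using closed_outer_region
    by (intro closed_Collect_conj closed_Collect_le continuous_intros) simp_all
  moreover have "?A \<subseteq> ?C"
    by (auto intro: achievable_outer_region achievable_outer_region[OF achievable_swap])
      (auto simp: achievable_def)
  ultimately have "R \<in> ?C"
    using R closure_minimal[of ?A ?C] unfolding capacity_region_def by blast
  then show "R \<in> DB1 \<inter> DB2"
    using outer_region_DB(1)[of "fst R" "snd R"] outer_region_DB(2)[of "snd R" "fst R"] by simp
qed

end
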